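(* Suppose $I$ is a stable matching instance with $k$-range preferences and $n$ men and $n$ women, and $\mathcal{R} = \mathcal{R}(I)$ is its rotation poset. Then the pathwidth of $\mathcal{R}$ is at most $50k^2$.
   Context: An SM instance $I$ has men and women with complete strict preference lists; $P_a(b)$ is the rank $a$ assigns $b$. For an agent $a$, $\min\mathrm{rank}(a)$ and $\max\mathrm{rank}(a)$ are the minimum and maximum of $P_b(a)$ over agents $b$ of the opposite sex; $I$ has $k$-range preferences if $\max\mathrm{rank}(a) - \min\mathrm{rank}(a) \leq k-1$ for all $a$. The rotation poset $\mathcal{R}(I)$ is the poset on the rotations of $I$ whose downsets correspond one-to-one with the stable matchings of $I$. A path decomposition of a graph $G=(V,E)$ is a sequence $(X_1,\ldots,X_r)$ of subsets of $V$ covering $V$ such that every edge lies in some $X_i$ and $X_i\cap X_k\subseteq X_j$ for $i\le j\le k$; its width is $\max_i|X_i|-1$, and the pathwidth of $G$ is the minimum width. The pathwidth of a poset is the pathwidth of the undirected version of its Hasse diagram. *)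

theory Defs
  imports Main
begin

(* An SM instance with n men and n women, both indexed by {0..<n}.
   pm m w = rank that man m assigns to woman w; pw w m = rank woman w assigns man m.
   Ranks are 0-based positions (only differences/comparisons matter). *)

definition sm_instance :: "nat \<Rightarrow> (nat \<Rightarrow> nat \<Rightarrow> nat) \<Rightarrow> (nat \<Rightarrow> nat \<Rightarrow> nat) \<Rightarrow> bool" where
  "sm_instance n pm pw \<longleftrightarrow>
     (\<forall>m<n. bij_betw (pm m) {..<n} {..<n}) \<and> (\<forall>w<n. bij_betw (pw w) {..<n} {..<n})"

definition k_range :: "nat \<Rightarrow> (nat \<Rightarrow> nat \<Rightarrow> nat) \<Rightarrow> (nat \<Rightarrow> nat \<Rightarrow> nat) \<Rightarrow> nat \<Rightarrow> bool" where
  "k_range n pm pw k \<longleftrightarrow>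
     (\<forall>w<n. \<forall>m<n. \<forall>m'<n. int (pm m w) - int (pm m' w) \<le> int k - 1) \<and>
     (\<forall>m<n. \<forall>w<n. \<forall>w'<n. int (pw w m) - int (pw w' m) \<le> int k - 1)"

(* matchings as sets of (man, woman) pairs; complete lists => perfect matchings *)
definition perfect_matching :: "nat \<Rightarrow> (nat \<times> nat) set \<Rightarrow> bool" where
  "perfect_matching n M \<longleftrightarrow> M \<subseteq> {..<n} \<times> {..<n} \<and>
     (\<forall>m<n. \<exists>!w. (m, w) \<in> M) \<and> (\<forall>w<n. \<exists>!m. (m, w) \<in> M)"

definition stable :: "nat \<Rightarrow> (nat \<Rightarrow> nat \<Rightarrow> nat) \<Rightarrow> (nat \<Rightarrow> nat \<Rightarrow> nat) \<Rightarrow> (nat \<times> nat) set \<Rightarrow> bool" where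
  "stable n pm pw M \<longleftrightarrow> perfect_matching n M \<and>
     \<not> (\<exists>m w m' w'. (m, w') \<in> M \<and> (m', w) \<in> M \<and> pm m w < pm m w' \<and> pw w m < pw w m')"

definition man_optimal :: "nat \<Rightarrow> (nat \<Rightarrow> nat \<Rightarrow> nat) \<Rightarrow> (nat \<Rightarrow> nat \<Rightarrow> nat) \<Rightarrow> (nat \<times> nat) set \<Rightarrow> bool" where
  "man_optimal n pm pw M0 \<longleftrightarrow> stable n pm pw M0 \<and>
     (\<forall>M. stable n pm pw M \<longrightarrow> (\<forall>m w w'. (m, w) \<in> M0 \<longrightarrow> (m, w') \<in> M \<longrightarrow> pm m w \<le> pm m w'))"

definition next_woman :: "nat \<Rightarrow> (nat \<Rightarrow> nat \<Rightarrow> nat) \<Rightarrow> (nat \<Rightarrow> nat \<Rightarrow> nat) \<Rightarrow> (nat \<times> nat) set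
    \<Rightarrow> nat \<Rightarrow> nat \<Rightarrow> bool" where
  "next_woman n pm pw M m w \<longleftrightarrow> w < n \<and>
     (\<exists>w0. (m, w0) \<in> M \<and> pm m w0 < pm m w \<and>
        (\<exists>m'. (m', w) \<in> M \<and> pw w m < pw w m') \<and>
        (\<forall>w'. w' < n \<and> pm m w0 < pm m w' \<and> pm m w' < pm m w \<longrightarrow>
           \<not> (\<exists>m'. (m', w') \<in> M \<and> pw w' m < pw w' m')))"

(* A rotation is represented by the set of triples (m_i, w_i, w_{i+1}):
   man m_i is matched to w_i and moves to w_{i+1} when the rotation is eliminated. *)
type_synonym rotation = "(nat \<times> nat \<times> nat) set"

definition exposed :: "nat \<Rightarrow> (nat \<Rightarrow> nat \<Rightarrow> nat) \<Rightarrow> (nat \<Rightarrow> nat \<Rightarrow> nat) \<Rightarrow> (nat \<times> nat) set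
    \<Rightarrow> rotation \<Rightarrow> bool" where
  "exposed n pm pw M \<rho> \<longleftrightarrow> (\<exists>ps :: (nat \<times> nat) list. 2 \<le> length ps \<and> distinct (map fst ps) \<and>
     (\<forall>i < length ps. ps ! i \<in> M \<and>
        next_woman n pm pw M (fst (ps ! i)) (snd (ps ! ((i + 1) mod length ps)))) \<and>
     \<rho> = {(fst (ps ! i), snd (ps ! i), snd (ps ! ((i + 1) mod length ps))) | i. i < length ps})"

definition eliminate :: "(nat \<times> nat) set \<Rightarrow> rotation \<Rightarrow> (nat \<times> nat) set" where
  "eliminate M \<rho> = (M - {(m, w) | m w w'. (m, w, w') \<in> \<rho>}) \<union> {(m, w') | m w w'. (m, w, w') \<in> \<rho>}"

inductive elim_seq :: "nat \<Rightarrow> (nat \<Rightarrow> nat \<Rightarrow> nat) \<Rightarrow> (nat \<Rightarrow> nat \<Rightarrow> nat) \<Rightarrow> (nat \<times> nat) set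
    \<Rightarrow> rotation list \<Rightarrow> (nat \<times> nat) set \<Rightarrow> bool"
  for n pm pw M0 where
  Nil: "elim_seq n pm pw M0 [] M0"
| Snoc: "elim_seq n pm pw M0 rs M \<Longrightarrow> exposed n pm pw M \<rho> \<Longrightarrow>
         elim_seq n pm pw M0 (rs @ [\<rho>]) (eliminate M \<rho>)"

definition rotations :: "nat \<Rightarrow> (nat \<Rightarrow> nat \<Rightarrow> nat) \<Rightarrow> (nat \<Rightarrow> nat \<Rightarrow> nat) \<Rightarrow> rotation set" where
  "rotations n pm pw = {\<rho>. \<exists>M. stable n pm pw M \<and> exposed n pm pw M \<rho>}"

definition rot_le :: "nat \<Rightarrow> (nat \<Rightarrow> nat \<Rightarrow> nat) \<Rightarrow> (nat \<Rightarrow> nat \<Rightarrow> nat) \<Rightarrow> rotation \<Rightarrow> rotation \<Rightarrow> bool" where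
  "rot_le n pm pw \<rho> \<pi> \<longleftrightarrow> \<rho> \<in> rotations n pm pw \<and> \<pi> \<in> rotations n pm pw \<and>
     (\<rho> = \<pi> \<or> (\<forall>M0 rs M. man_optimal n pm pw M0 \<longrightarrow> elim_seq n pm pw M0 rs M \<longrightarrow> \<pi> \<in> set rs \<longrightarrow>
                      \<rho> \<in> set (takeWhile (\<lambda>x. x \<noteq> \<pi>) rs)))"

definition rot_lt :: "nat \<Rightarrow> (nat \<Rightarrow> nat \<Rightarrow> nat) \<Rightarrow> (nat \<Rightarrow> nat \<Rightarrow> nat) \<Rightarrow> rotation \<Rightarrow> rotation \<Rightarrow> bool" where
  "rot_lt n pm pw \<rho> \<pi> \<longleftrightarrow> rot_le n pm pw \<rho> \<pi> \<and> \<rho> \<noteq> \<pi>"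

definition hasse_edge :: "nat \<Rightarrow> (nat \<Rightarrow> nat \<Rightarrow> nat) \<Rightarrow> (nat \<Rightarrow> nat \<Rightarrow> nat) \<Rightarrow> rotation \<Rightarrow> rotation \<Rightarrow> bool" where
  "hasse_edge n pm pw \<rho> \<pi> \<longleftrightarrow>
     (let cov = (\<lambda>a b. rot_lt n pm pw a b \<and> \<not> (\<exists>c. rot_lt n pm pw a c \<and> rot_lt n pm pw c b))
      in cov \<rho> \<pi> \<or> cov \<pi> \<rho>)"

definition path_decomposition :: "'v set \<Rightarrow> ('v \<Rightarrow> 'v \<Rightarrow> bool) \<Rightarrow> 'v set list \<Rightarrow> bool" where
  "path_decomposition V E Xs \<longleftrightarrow>
     (\<forall>X \<in> set Xs. X \<subseteq> V) \<and> V \<subseteq> \<Union> (set Xs) \<and>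
     (\<forall>u \<in> V. \<forall>v \<in> V. E u v \<longrightarrow> (\<exists>X \<in> set Xs. u \<in> X \<and> v \<in> X)) \<and>
     (\<forall>i j k. i \<le> j \<and> j \<le> k \<and> k < length Xs \<longrightarrow> Xs ! i \<inter> Xs ! k \<subseteq> Xs ! j)"

(* pathwidth = least w such that some path decomposition has all bags of size <= w + 1
   (natural-number valued; for an empty graph this is 0 rather than -1) *)
definition pathwidth :: "'v set \<Rightarrow> ('v \<Rightarrow> 'v \<Rightarrow> bool) \<Rightarrow> nat" where
  "pathwidth V E = (LEAST w. \<exists>Xs. path_decomposition V E Xs \<and> (\<forall>X \<in> set Xs. card X \<le> w + 1))"

end

(* Give every agent the position "rank assigned by agent 0 of the other side". Under k-range
   preferences the partners in a stable matching have positions that differ by less than 3k, and a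
   man and a woman lie together in at most one rotation, so at most 48k^2 rotations contain a step
   that crosses a given position. Taking these as the bags of a path decomposition, one bag per
   position, it remains to see that Hasse neighbours share a bag. If rho is covered by pi, there is
   a stable matching that exposes rho but not pi, and exposes pi once rho is eliminated. Hence rho
   and pi have a woman in common, or a man of pi moves from above to below a woman of rho in his
   list; in both cases they occupy overlapping ranges of positions. *)

theory Submission
  imports Defs
begin

text \<open>The order on rotations is defined through all elimination sequences, and these are
  awkward to compare. The predicate \<open>passed\<close> replaces them: whether a rotation was
  eliminated on the way to a stable matching can be read off the matching itself, because either all
  men of the rotation have moved on or none has. The order then speaks of matchings only, and joins
  and meets supply extremal matchings with prescribed exposed or passed rotations; the two
  neighbouring matchings behind a covering pair arise in this way. Stability and exposure are judged
  in each agent's own list, whereas the bags need one common scale. Every change of judge costs k-1.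
  This is the source of the slack 2k in the bags and of the two factors, below 8k and 6k, whose
  product bounds their size.\<close>

definition wife :: "(nat \<times> nat) set \<Rightarrow> nat \<Rightarrow> nat" where
  "wife M m = (THE w. (m, w) \<in> M)"

definition husb :: "(nat \<times> nat) set \<Rightarrow> nat \<Rightarrow> nat" where
  "husb M w = (THE m. (m, w) \<in> M)"

text \<open>Joins, meets and the results of eliminations are all treated as graphs of partner
  functions.\<close>

definition graph_on :: "nat \<Rightarrow> (nat \<Rightarrow> nat) \<Rightarrow> (nat \<times> nat) set" where
  "graph_on n f = {(m, f m) | m. m < n}"

section \<open>Stable matchings through partner functions, blocking pairs and dominance\<close>

locale sm =
  fixes n :: nat and pm pw :: "nat \<Rightarrow> nat \<Rightarrow> nat"
  assumes inst: "sm_instance n pm pw"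
begin

abbreviation stab :: "(nat \<times> nat) set \<Rightarrow> bool" where
  "stab \<equiv> stable n pm pw"

abbreviation expo :: "(nat \<times> nat) set \<Rightarrow> rotation \<Rightarrow> bool" where
  "expo \<equiv> exposed n pm pw"

abbreviation man_rank :: "(nat \<times> nat) set \<Rightarrow> nat \<Rightarrow> nat" where
  "man_rank M m \<equiv> pm m (wife M m)"

abbreviation woman_rank :: "(nat \<times> nat) set \<Rightarrow> nat \<Rightarrow> nat" where
  "woman_rank M w \<equiv> pw w (husb M w)"

text \<open>Smaller ranks are better, so the man-optimal matching is the least element of this
  order.\<close>

definition dom :: "(nat \<times> nat) set \<Rightarrow> (nat \<times> nat) set \<Rightarrow> bool" where
  "dom M M' \<longleftrightarrow> (\<forall>m<n. man_rank M m \<le> man_rank M' m)"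

lemma pm_inj: "m < n \<Longrightarrow> w < n \<Longrightarrow> w' < n \<Longrightarrow> pm m w = pm m w' \<Longrightarrow> w = w'"
  using inst unfolding sm_instance_def by (meson bij_betw_imp_inj_on inj_onD lessThan_iff)

lemma pw_inj: "w < n \<Longrightarrow> m < n \<Longrightarrow> m' < n \<Longrightarrow> pw w m = pw w m' \<Longrightarrow> m = m'"
  using inst unfolding sm_instance_def by (meson bij_betw_imp_inj_on inj_onD lessThan_iff)

lemma perfect_wife: "perfect_matching n M \<Longrightarrow> m < n \<Longrightarrow> (m, wife M m) \<in> M"
  unfolding perfect_matching_def wife_def by (metis (mono_tags, lifting) theI')

lemma perfect_husb: "perfect_matching n M \<Longrightarrow> w < n \<Longrightarrow> (husb M w, w) \<in> M"
  unfolding perfect_matching_def husb_def by (metis (mono_tags, lifting) theI')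

lemma perfect_pair_wife: "perfect_matching n M \<Longrightarrow> (m, w) \<in> M \<longleftrightarrow> m < n \<and> wife M m = w"
  using perfect_wife[of M m] unfolding perfect_matching_def by blast

lemma perfect_pair_husb: "perfect_matching n M \<Longrightarrow> (m, w) \<in> M \<longleftrightarrow> w < n \<and> husb M w = m"
  using perfect_husb[of M w] unfolding perfect_matching_def by blast

lemma stab_perfect: "stab M \<Longrightarrow> perfect_matching n M"
  by (simp add: stable_def)

lemma pair_wife: "stab M \<Longrightarrow> (m, w) \<in> M \<longleftrightarrow> m < n \<and> wife M m = w"
  using perfect_pair_wife stab_perfect by blast

lemma pair_husb: "stab M \<Longrightarrow> (m, w) \<in> M \<longleftrightarrow> w < n \<and> husb M w = m"
  using perfect_pair_husb stab_perfect by blast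

lemma wife_lt [simp]: "stab M \<Longrightarrow> m < n \<Longrightarrow> wife M m < n"
  using pair_wife pair_husb by blast

lemma husb_lt [simp]: "stab M \<Longrightarrow> w < n \<Longrightarrow> husb M w < n"
  using pair_wife pair_husb by blast

lemma husb_wife [simp]: "stab M \<Longrightarrow> m < n \<Longrightarrow> husb M (wife M m) = m"
  using pair_wife pair_husb by blast

lemma wife_husb [simp]: "stab M \<Longrightarrow> w < n \<Longrightarrow> wife M (husb M w) = w"
  using pair_wife pair_husb by blast

lemma wife_inj: "stab M \<Longrightarrow> m < n \<Longrightarrow> m' < n \<Longrightarrow> wife M m = wife M m' \<Longrightarrow> m = m'"
  by (metis husb_wife)

lemma no_block:
  assumes "stab M" "m < n" "w < n" "pm m w < man_rank M m"
  shows "woman_rank M w < pw w m"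
proof -
  have "\<not> pw w m < woman_rank M w"
    using assms pair_wife[of M] pair_husb[of M] unfolding stable_def by blast
  moreover have "husb M w \<noteq> m"
    using assms wife_husb by fastforce
  ultimately show ?thesis
    using pw_inj[of w m "husb M w"] assms husb_lt[of M w] by fastforce
qed

lemma no_block_woman:
  assumes "stab M" "m < n" "w < n" "pw w m < woman_rank M w"
  shows "man_rank M m < pm m w"
proof -
  have "wife M m \<noteq> w" using assms by auto
  then show ?thesis
    using no_block[OF assms(1-3)] assms(4) pm_inj[OF assms(2,3) wife_lt[OF assms(1,2)]]
    by force
qed

lemma stable_eqI:
  assumes "stab M" "stab M'" "\<And>m. m < n \<Longrightarrow> wife M m = wife M' m"
  shows "M = M'"
  using assms pair_wife[OF assms(1)] pair_wife[OF assms(2)] by auto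

lemma dom_trans: "dom M M' \<Longrightarrow> dom M' M'' \<Longrightarrow> dom M M''"
  unfolding dom_def by (meson order_trans)

lemma dom_antisym: "stab M \<Longrightarrow> stab M' \<Longrightarrow> dom M M' \<Longrightarrow> dom M' M \<Longrightarrow> M = M'"
  unfolding dom_def by (meson le_antisym pm_inj stable_eqI wife_lt)

text \<open>An injective self-map of a finite set is onto, so injectivity alone gives every woman
  exactly one husband.\<close>

lemma perfect_graph:
  assumes inj: "inj_on f {..<n}" and ran: "\<And>m. m < n \<Longrightarrow> f m < n"
  shows "perfect_matching n (graph_on n f)" "\<And>m. m < n \<Longrightarrow> wife (graph_on n f) m = f m"
proof -
  have "f ` {..<n} = {..<n}"
    using inj ran by (intro endo_inj_surj) auto
  then have "\<exists>m<n. f m = w" if "w < n" for w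
    using that by (metis imageE lessThan_iff)
  then show p: "perfect_matching n (graph_on n f)"
    using inj ran unfolding perfect_matching_def graph_on_def inj_on_def by blast
  show "wife (graph_on n f) m = f m" if "m < n" for m
    using perfect_pair_wife[OF p, of m "f m"] that unfolding graph_on_def by blast
qed

lemma stableI:
  assumes "perfect_matching n M"
    and "\<And>m w. m < n \<Longrightarrow> w < n \<Longrightarrow> pm m w < man_rank M m \<Longrightarrow> pw w m < woman_rank M w \<Longrightarrow> False"
  shows "stab M"
  unfolding stable_def
proof (intro conjI notI)
  assume "\<exists>m w m' w'. (m, w') \<in> M \<and> (m', w) \<in> M \<and> pm m w < pm m w' \<and> pw w m < pw w m'"
  then obtain m w m' w' where "(m, w') \<in> M" "(m', w) \<in> M" "pm m w < pm m w'" "pw w m < pw w m'"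
    by blast
  then show False
    using assms(2)[of m w] perfect_pair_wife[OF assms(1), of m w'] perfect_pair_husb[OF assms(1), of m' w]
    by simp
qed (rule assms(1))

text \<open>Writing the woman of a potential blocking pair as \<open>f h\<close> makes
  \<open>h\<close> her husband, so the check avoids \<open>husb\<close>.\<close>

lemma stable_graphI:
  assumes inj: "inj_on f {..<n}" and ran: "\<And>m. m < n \<Longrightarrow> f m < n"
    and nb: "\<And>m h. m < n \<Longrightarrow> h < n \<Longrightarrow> pm m (f h) < pm m (f m) \<Longrightarrow> pw (f h) m < pw (f h) h \<Longrightarrow> False"
  shows "stab (graph_on n f)"
proof (rule stableI)
  note p = perfect_graph[OF inj ran]
  show "perfect_matching n (graph_on n f)" by (rule p(1))
  fix m w assume a: "m < n" "w < n" "pm m w < man_rank (graph_on n f) m"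
    "pw w m < woman_rank (graph_on n f) w"
  define h where "h = husb (graph_on n f) w"
  have "h < n" "f h = w"
    using perfect_pair_husb[OF p(1), of h w] perfect_pair_wife[OF p(1), of h w] a(2) p(2) h_def by auto
  then show False using nb[of m h] a p(2)[of m] h_def by auto
qed

lemma man_rank_less:
  assumes "stab M" "stab M'" "m < n" "wife M m \<noteq> wife M' m" "man_rank M m \<le> man_rank M' m"
  shows "man_rank M m < man_rank M' m"
  using assms pm_inj[OF assms(3) wife_lt[OF assms(1,3)] wife_lt[OF assms(2,3)]] by linarith

text \<open>Otherwise \<open>m\<close> and his wife in \<open>M\<close> would block
  \<open>M'\<close>.\<close>

lemma opposite_fst:
  assumes "stab M" "stab M'" "m < n" "man_rank M m < man_rank M' m"
  shows "woman_rank M' (wife M m) < pw (wife M m) m"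
  using no_block[of M' m "wife M m"] assms by auto

text \<open>Both partners of a man who prefers \<open>M\<close> prefer \<open>M'\<close>: the current partners by stability, and
  the partners in \<open>M'\<close> by counting, since \<open>M\<close> and \<open>M'\<close> inject these two sets into each other.\<close>

lemma opposite_snd:
  assumes M: "stab M" "stab M'" and m: "m < n" "man_rank M m < man_rank M' m"
  shows "pw (wife M' m) m < woman_rank M (wife M' m)"
proof -
  define A where "A = {m. m < n \<and> man_rank M m < man_rank M' m}"
  define B where "B = {w. w < n \<and> woman_rank M' w < woman_rank M w}"
  have fin: "finite A" "finite B" unfolding A_def B_def by auto
  have "wife M ` A \<subseteq> B"
  proof (rule image_subsetI)
    fix m assume "m \<in> A"
    then have m: "m < n" "man_rank M m < man_rank M' m" unfolding A_def by auto
    then show "wife M m \<in> B"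
      using opposite_fst[OF M m] M(1) unfolding B_def by simp
  qed
  moreover have "inj_on (wife M) A"
    using wife_inj[OF M(1)] unfolding A_def inj_on_def by blast
  ultimately have c1: "card A \<le> card B" using fin by (metis card_inj_on_le)
  have img: "husb M' ` B \<subseteq> A"
  proof (rule image_subsetI)
    fix w assume "w \<in> B"
    then have w: "w < n" "woman_rank M' w < woman_rank M w" unfolding B_def by auto
    then show "husb M' w \<in> A"
      using no_block_woman[OF M(1) husb_lt[OF M(2) w(1)] w] husb_lt[OF M(2) w(1)] M(2)
      unfolding A_def by simp
  qed
  have inj: "inj_on (husb M') B"
    by (rule inj_on_inverseI[where g = "wife M'"]) (simp add: B_def M(2))
  have "husb M' ` B = A"
    using card_seteq[OF fin(1) img] c1 card_image[OF inj] by simp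
  moreover have "m \<in> A" using m A_def by auto
  ultimately obtain w where w: "w \<in> B" "m = husb M' w" by blast
  then have "w < n" "woman_rank M' w < woman_rank M w" unfolding B_def by auto
  then show ?thesis using w(2) M(2) by simp
qed

subsection \<open>The lattice of stable matchings\<close>

text \<open>The name refers to the men's satisfaction: each man keeps the better partner, so the
  join lies below both matchings in \<open>dom\<close>.\<close>

definition join :: "(nat \<times> nat) set \<Rightarrow> (nat \<times> nat) set \<Rightarrow> (nat \<times> nat) set" where
  "join M M' = graph_on n (\<lambda>m. if man_rank M m \<le> man_rank M' m then wife M m else wife M' m)"

definition meet :: "(nat \<times> nat) set \<Rightarrow> (nat \<times> nat) set \<Rightarrow> (nat \<times> nat) set" where
  "meet M M' = graph_on n (\<lambda>m. if man_rank M' m \<le> man_rank M m then wife M m else wife M' m)"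

text \<open>If her husband changes, then her husband in \<open>M\<close> strictly prefers
  \<open>M\<close>, and \<open>opposite_fst\<close> applies to him.\<close>

lemma woman_dom:
  assumes "stab M" "stab M'" "dom M M'" "w < n"
  shows "woman_rank M' w \<le> woman_rank M w"
proof (cases "wife M' (husb M w) = w")
  case True
  then have "husb M' w = husb M w" using husb_wife[OF assms(2) husb_lt[OF assms(1,4)]] by simp
  then show ?thesis by simp
next
  case False
  then have "man_rank M (husb M w) < man_rank M' (husb M w)"
    using assms pm_inj[of "husb M w" w "wife M' (husb M w)"] unfolding dom_def
    by (metis husb_lt le_neq_implies_less wife_husb wife_lt)
  from opposite_fst[OF assms(1,2) husb_lt[OF assms(1,4)] this] show ?thesis using assms by simp
qed

lemma inj_choice:
  assumes M: "stab M" "stab M'"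
    and clash: "\<And>m m'. m < n \<Longrightarrow> m' < n \<Longrightarrow> m \<noteq> m' \<Longrightarrow> P m \<Longrightarrow> \<not> P m' \<Longrightarrow> wife M m \<noteq> wife M' m'"
  shows "inj_on (\<lambda>m. if P m then wife M m else wife M' m) {..<n}"
proof (rule inj_onI)
  fix x y assume a: "x \<in> {..<n}" "y \<in> {..<n}"
    "(if P x then wife M x else wife M' x) = (if P y then wife M y else wife M' y)"
  then have xy: "x < n" "y < n" by auto
  show "x = y"
  proof (rule ccontr)
    assume ne: "x \<noteq> y"
    then have "wife M x \<noteq> wife M y" "wife M' x \<noteq> wife M' y"
      using wife_inj[OF M(1) xy] wife_inj[OF M(2) xy] by blast+
    moreover have "P x \<Longrightarrow> \<not> P y \<Longrightarrow> wife M x \<noteq> wife M' y" "P y \<Longrightarrow> \<not> P x \<Longrightarrow> wife M y \<noteq> wife M' x"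
      using clash[OF xy ne] clash[OF xy(2,1) ne[symmetric]] by blast+
    ultimately show False using a(3) by (auto split: if_splits)
  qed
qed

text \<open>Two men who choose the same woman from different matchings both strictly prefer their
  choice, and then \<open>opposite_fst\<close> makes her prefer each of them to the other. A man who
  blocks the join improves on both of his wives, so the woman rejects him in both matchings, and her
  husband in the join is one of her two husbands.\<close>

lemma join_facts:
  assumes M: "stab M" "stab M'"
  shows "stab (join M M')"
    and "\<And>m. m < n \<Longrightarrow> wife (join M M') m = (if man_rank M m \<le> man_rank M' m then wife M m else wife M' m)"
proof -
  define J where "J m = (if man_rank M m \<le> man_rank M' m then wife M m else wife M' m)" for m
  have clash: False if "m < n" "m' < n" "m \<noteq> m'" "man_rank M m \<le> man_rank M' m"
    "man_rank M' m' \<le> man_rank M m'" "wife M m = wife M' m'" for m m'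
  proof -
    have "wife M m \<noteq> wife M' m" "wife M' m' \<noteq> wife M m'"
      using wife_inj[OF M(2) that(1,2)] wife_inj[OF M(1) that(1,2)] that(3,6) by auto
    then have "man_rank M m < man_rank M' m" "man_rank M' m' < man_rank M m'"
      using man_rank_less[OF M that(1)] man_rank_less[OF M(2,1) that(2)] that(4,5) by auto
    from opposite_fst[OF M that(1) this(1)] opposite_fst[OF M(2,1) that(2) this(2)]
    show False using husb_wife[OF M(1) that(1)] husb_wife[OF M(2) that(2)] that(6) by simp
  qed
  have inj: "inj_on J {..<n}"
    unfolding J_def by (rule inj_choice[OF M]) (use clash less_imp_le_nat[OF not_le_imp_less] in blast)
  have ran: "J m < n" if "m < n" for m using that M unfolding J_def by auto
  have g: "join M M' = graph_on n J" unfolding join_def J_def ..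
  show "stab (join M M')" unfolding g
  proof (rule stable_graphI[OF inj ran])
    fix m h assume a: "m < n" "h < n" "pm m (J h) < pm m (J m)" "pw (J h) m < pw (J h) h"
    have "pm m (J h) < man_rank M m" "pm m (J h) < man_rank M' m"
      using a(3) unfolding J_def[of m] by (simp_all split: if_splits)
    then have "woman_rank M (J h) < pw (J h) m" "woman_rank M' (J h) < pw (J h) m"
      using no_block[OF M(1) a(1) ran[OF a(2)]] no_block[OF M(2) a(1) ran[OF a(2)]] by simp_all
    then show False using a(2,4) husb_wife[OF M(1) a(2)] husb_wife[OF M(2) a(2)]
      unfolding J_def by (simp split: if_splits)
  qed
  show "\<And>m. m < n \<Longrightarrow> wife (join M M') m = (if man_rank M m \<le> man_rank M' m then wife M m else wife M' m)"
    unfolding g using perfect_graph(2)[OF inj ran] unfolding J_def by auto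
qed

text \<open>Dual to the join, but a clash is now excluded by \<open>opposite_snd\<close>, the half
  that rests on counting.\<close>

lemma meet_facts:
  assumes M: "stab M" "stab M'"
  shows "stab (meet M M')"
    and "\<And>m. m < n \<Longrightarrow> wife (meet M M') m = (if man_rank M' m \<le> man_rank M m then wife M m else wife M' m)"
proof -
  define J where "J m = (if man_rank M' m \<le> man_rank M m then wife M m else wife M' m)" for m
  have clash: False if "m < n" "m' < n" "m \<noteq> m'" "man_rank M' m \<le> man_rank M m"
    "man_rank M m' \<le> man_rank M' m'" "wife M m = wife M' m'" for m m'
  proof -
    have "wife M' m \<noteq> wife M m" "wife M m' \<noteq> wife M' m'"
      using wife_inj[OF M(2) that(1,2)] wife_inj[OF M(1) that(1,2)] that(3,6) by auto
    then have "man_rank M' m < man_rank M m" "man_rank M m' < man_rank M' m'"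
      using man_rank_less[OF M(2,1) that(1)] man_rank_less[OF M that(2)] that(4,5) by auto
    from opposite_snd[OF M(2,1) that(1) this(1)] opposite_snd[OF M that(2) this(2)]
    show False using husb_wife[OF M(1) that(1)] husb_wife[OF M(2) that(2)] that(6) by simp
  qed
  have inj: "inj_on J {..<n}"
    unfolding J_def by (rule inj_choice[OF M]) (use clash less_imp_le_nat[OF not_le_imp_less] in blast)
  have ran: "J m < n" if "m < n" for m using that M unfolding J_def by auto
  have g: "meet M M' = graph_on n J" unfolding meet_def J_def ..
  \<comment> \<open>Each woman gets the better of her two husbands, while a man who blocks the meet
    improves on at least one of his wives; so the pair would block one of the given
    matchings.\<close>
  have better: "pw (J h) h \<le> woman_rank M (J h)" "pw (J h) h \<le> woman_rank M' (J h)" if "h < n" for h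
  proof -
    consider "man_rank M' h < man_rank M h" | "wife M' h = wife M h" | "man_rank M h < man_rank M' h"
      using man_rank_less[OF M \<open>h < n\<close>] by fastforce
    then have "pw (J h) h \<le> woman_rank M (J h) \<and> pw (J h) h \<le> woman_rank M' (J h)"
      using opposite_snd[OF M \<open>h < n\<close>] opposite_snd[OF M(2,1) \<open>h < n\<close>]
        husb_wife[OF M(1) \<open>h < n\<close>] husb_wife[OF M(2) \<open>h < n\<close>]
      unfolding J_def by cases simp_all
    then show "pw (J h) h \<le> woman_rank M (J h)" "pw (J h) h \<le> woman_rank M' (J h)" by auto
  qed
  show "stab (meet M M')" unfolding g
  proof (rule stable_graphI[OF inj ran])
    fix m h assume a: "m < n" "h < n" "pm m (J h) < pm m (J m)" "pw (J h) m < pw (J h) h"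
    have "pm m (J h) < man_rank M m \<or> pm m (J h) < man_rank M' m"
      using a(3) unfolding J_def[of m] by (simp split: if_splits)
    then have "woman_rank M (J h) < pw (J h) m \<or> woman_rank M' (J h) < pw (J h) m"
      using no_block[OF M(1) a(1) ran[OF a(2)]] no_block[OF M(2) a(1) ran[OF a(2)]] by blast
    then show False using better[of h] a by auto
  qed
  show "\<And>m. m < n \<Longrightarrow> wife (meet M M') m = (if man_rank M' m \<le> man_rank M m then wife M m else wife M' m)"
    unfolding g using perfect_graph(2)[OF inj ran] unfolding J_def by auto
qed

lemma man_rank_join:
  "stab M \<Longrightarrow> stab M' \<Longrightarrow> m < n \<Longrightarrow> man_rank (join M M') m = min (man_rank M m) (man_rank M' m)"
  using join_facts(2) by auto

lemma man_rank_meet: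
  "stab M \<Longrightarrow> stab M' \<Longrightarrow> m < n \<Longrightarrow> man_rank (meet M M') m = max (man_rank M m) (man_rank M' m)"
  using meet_facts(2) by auto

lemma dom_join:
  assumes "stab M" "stab M'"
  shows "dom (join M M') M" "dom (join M M') M'"
  using man_rank_join[OF assms] unfolding dom_def by auto

lemma dom_meet:
  assumes "stab M" "stab M'"
  shows "dom M (meet M M')" "dom M' (meet M M')"
  using man_rank_meet[OF assms] unfolding dom_def by auto

subsection \<open>Exposed rotations\<close>

lemma next_woman_iff:
  assumes "stab M"
  shows "next_woman n pm pw M m w \<longleftrightarrow> m < n \<and> w < n \<and> man_rank M m < pm m w \<and>
    pw w m < woman_rank M w \<and>
    (\<forall>v<n. man_rank M m < pm m v \<longrightarrow> pm m v < pm m w \<longrightarrow> woman_rank M v \<le> pw v m)"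
proof -
  have *: "(\<exists>m'. (m', v) \<in> M \<and> pw v m < pw v m') \<longleftrightarrow> v < n \<and> pw v m < woman_rank M v" for v
    by (simp add: pair_husb[OF assms])
  have **: "(\<exists>w0. (m, w0) \<in> M \<and> P w0) \<longleftrightarrow> m < n \<and> P (wife M m)" for P
    by (simp add: pair_wife[OF assms])
  show ?thesis unfolding next_woman_def * ** by (auto simp: not_less)
qed

lemma expo_next: "expo M \<rho> \<Longrightarrow> (m, w, w') \<in> \<rho> \<Longrightarrow> (m, w) \<in> M \<and> next_woman n pm pw M m w'"
  unfolding exposed_def by auto

lemma expoE:
  assumes "expo M \<rho>" "stab M" "(m, w, w') \<in> \<rho>"
  shows "m < n" "w < n" "w' < n" "wife M m = w" "husb M w = m" "pm m w < pm m w'"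
    "pw w' m < woman_rank M w'"
    "\<And>v. v < n \<Longrightarrow> pm m w < pm m v \<Longrightarrow> pm m v < pm m w' \<Longrightarrow> woman_rank M v \<le> pw v m"
proof -
  have *: "(m, w) \<in> M" "next_woman n pm pw M m w'"
    using expo_next[OF assms(1,3)] by auto
  show w: "m < n" "w < n" "wife M m = w" "husb M w = m"
    using pair_wife[OF assms(2), of m w] pair_husb[OF assms(2), of m w] *(1) by auto
  show "w' < n" "pm m w < pm m w'" "pw w' m < woman_rank M w'"
    "\<And>v. v < n \<Longrightarrow> pm m w < pm m v \<Longrightarrow> pm m v < pm m w' \<Longrightarrow> woman_rank M v \<le> pw v m"
    using *(2) w(3) unfolding next_woman_iff[OF assms(2)] by auto
qed

lemma expo_succ:
  assumes "expo M \<rho>" "(m, w, w') \<in> \<rho>"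
  shows "\<exists>m' w''. (m', w', w'') \<in> \<rho>"
proof -
  obtain ps where ps: "2 \<le> length ps"
    "\<rho> = {(fst (ps ! i), snd (ps ! i), snd (ps ! ((i + 1) mod length ps))) | i. i < length ps}"
    using assms(1) unfolding exposed_def by auto
  then obtain i where "i < length ps" "w' = snd (ps ! ((i + 1) mod length ps))"
    using assms(2) by auto
  moreover have "(i + 1) mod length ps < length ps" using ps(1) by (intro mod_less_divisor) auto
  ultimately show ?thesis using ps(2) by blast
qed

lemma expo_pred:
  assumes "expo M \<rho>" "(m, w, w') \<in> \<rho>"
  shows "\<exists>m' v. (m', v, w) \<in> \<rho>"
proof -
  obtain ps where ps: "2 \<le> length ps"
    "\<rho> = {(fst (ps ! i), snd (ps ! i), snd (ps ! ((i + 1) mod length ps))) | i. i < length ps}"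
    using assms(1) unfolding exposed_def by auto
  then obtain i where i: "i < length ps" "w = snd (ps ! i)"
    using assms(2) by auto
  show ?thesis
  proof (cases i)
    case 0
    have "length ps - 1 + 1 = length ps" "length ps - 1 < length ps" using ps(1) by auto
    then have "(length ps - 1 + 1) mod length ps = i" "length ps - 1 < length ps"
      using 0 by simp_all
    then show ?thesis using ps(2) i by (metis (mono_tags, lifting) mem_Collect_eq)
  next
    case (Suc j)
    then have "(j + 1) mod length ps = i" "j < length ps" using i by auto
    then show ?thesis using ps(2) i by (metis (mono_tags, lifting) mem_Collect_eq)
  qed
qed

text \<open>Induction around the cycle: a property handed from each triple to the triple of its next
  woman reaches all triples. Later proofs need no index arithmetic.\<close>

lemma expo_cyclic_induct [consumes 3, case_names start step]:
  assumes "expo M \<rho>" "(m0, w0, w1) \<in> \<rho>" "(m, w, w') \<in> \<rho>"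
    and start: "P m0 w0 w1"
    and step: "\<And>a b c d e. (a, b, c) \<in> \<rho> \<Longrightarrow> (d, c, e) \<in> \<rho> \<Longrightarrow> P a b c \<Longrightarrow> P d c e"
  shows "P m w w'"
proof -
  obtain ps where ps: "2 \<le> length ps"
    "\<rho> = {(fst (ps ! i), snd (ps ! i), snd (ps ! ((i + 1) mod length ps))) | i. i < length ps}"
    using assms(1) unfolding exposed_def by auto
  define l where "l = length ps"
  define Q where "Q i = P (fst (ps ! i)) (snd (ps ! i)) (snd (ps ! ((i + 1) mod l)))" for i
  have mem: "(fst (ps ! i), snd (ps ! i), snd (ps ! ((i + 1) mod l))) \<in> \<rho>" if "i < l" for i
    using that ps(2) l_def by blast
  have l: "l > 0" using ps(1) l_def by linarith
  obtain i where i: "i < l" "Q i" using assms(2) start ps(2) unfolding Q_def l_def by auto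
  obtain j where j: "j < l" "m = fst (ps ! j)" "w = snd (ps ! j)" "w' = snd (ps ! ((j + 1) mod l))"
    using assms(3) ps(2) unfolding l_def by auto
  have "Q ((i + d) mod l)" for d
  proof (induction d)
    case 0
    then show ?case using i by simp
  next
    case (Suc d)
    let ?a = "(i + d) mod l"
    have a: "?a < l" "(?a + 1) mod l < l" using l by auto
    have "Q ((?a + 1) mod l)"
      using step[OF mem[OF a(1)] mem[OF a(2)]] Suc unfolding Q_def by blast
    then show ?case by (simp add: mod_Suc_eq)
  qed
  \<comment> \<open>From index \<open>i\<close>, walking on by \<open>l - i + j\<close> wraps around
    once and ends at \<open>j\<close>.\<close>
  from this[of "l - i + j"] have "Q j" using i(1) j(1) by (simp add: mod_add_left_eq)
  then show ?thesis using j unfolding Q_def by simp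
qed

text \<open>The list that witnesses the cycle can be kept; only the conditions on single triples
  depend on the matching.\<close>

lemma expo_transfer:
  assumes "expo M \<rho>"
    and "\<And>m w w'. (m, w, w') \<in> \<rho> \<Longrightarrow> (m, w) \<in> N \<and> next_woman n pm pw N m w'"
  shows "expo N \<rho>"
proof -
  obtain ps where ps: "2 \<le> length ps" "distinct (map fst ps)"
    "\<rho> = {(fst (ps ! i), snd (ps ! i), snd (ps ! ((i + 1) mod length ps))) | i. i < length ps}"
    using assms(1) unfolding exposed_def by auto
  have "ps ! i \<in> N \<and> next_woman n pm pw N (fst (ps ! i)) (snd (ps ! ((i + 1) mod length ps)))"
    if "i < length ps" for i
    using assms(2)[of "fst (ps ! i)" "snd (ps ! i)" "snd (ps ! ((i + 1) mod length ps))"] that ps(3)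
    by auto
  then show ?thesis
    unfolding exposed_def using ps by (intro exI[of _ ps]) blast
qed

lemma next_woman_unique:
  assumes "stab M" "next_woman n pm pw M m w" "next_woman n pm pw M m w'"
  shows "w = w'"
proof -
  have "\<not> pm m w < pm m w'" "\<not> pm m w' < pm m w" "m < n" "w < n" "w' < n"
    using assms(2,3) unfolding next_woman_iff[OF assms(1)] by (auto simp: not_less)
  then show ?thesis using pm_inj by (metis linorder_neqE_nat)
qed

lemma expo_functional:
  assumes "expo M \<rho>" "expo M \<pi>" "stab M" "(m, w, a) \<in> \<rho>" "(m, v, b) \<in> \<pi>"
  shows "w = v" "a = b"
  using assms expo_next pair_wife next_woman_unique by metis+

text \<open>In \<open>M\<close> a man determines his triple, and its last woman determines the next
  man as her husband. Agreement at one man thus spreads around the cycle.\<close>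

lemma expo_subset:
  assumes "expo M \<rho>" "expo M \<pi>" "stab M" "(m, w, a) \<in> \<rho>" "(m, v, b) \<in> \<pi>"
  shows "\<rho> \<subseteq> \<pi>"
proof clarify
  fix x y z assume "(x, y, z) \<in> \<rho>"
  with assms(1,4) show "(x, y, z) \<in> \<pi>"
  proof (induction rule: expo_cyclic_induct)
    case start
    then show ?case using expo_functional[OF assms] assms by auto
  next
    case (step a b c d e)
    then obtain d' e' where de: "(d', c, e') \<in> \<pi>" using expo_succ[OF assms(2)] by blast
    then have "d' = d" using expoE(5)[OF assms(2,3)] expoE(5)[OF assms(1,3)] step by metis
    then show ?case using de expo_functional[OF assms(1-3)] step by metis
  qed
qed

lemma expo_eq:
  assumes "expo M \<rho>" "expo M \<pi>" "stab M" "(m, w, a) \<in> \<rho>" "(m, v, b) \<in> \<pi>"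
  shows "\<rho> = \<pi>"
  using expo_subset assms by (meson subset_antisym)

lemma expo_nonempty: "expo M \<rho> \<Longrightarrow> \<exists>m w w'. (m, w, w') \<in> \<rho>"
  unfolding exposed_def by fastforce

subsection \<open>Eliminating rotations\<close>

text \<open>Expresses that \<open>\<rho>\<close> has been eliminated on the way to \<open>M\<close>,
  without mentioning a sequence. One man suffices as a witness by \<open>passed_all\<close>;
  \<open>elim_seq_passed\<close> gives the link to sequences.\<close>

definition passed :: "(nat \<times> nat) set \<Rightarrow> rotation \<Rightarrow> bool" where
  "passed M \<rho> \<longleftrightarrow> (\<exists>m w w'. (m, w, w') \<in> \<rho> \<and> pm m w < man_rank M m)"

abbreviation rots :: "rotation set" where
  "rots \<equiv> rotations n pm pw"

lemma rotsE:
  assumes "\<rho> \<in> rots"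
  obtains M where "stab M" "expo M \<rho>"
  using assms unfolding rotations_def by blast

lemma rotsI: "stab M \<Longrightarrow> expo M \<rho> \<Longrightarrow> \<rho> \<in> rots"
  unfolding rotations_def by blast

lemma rots_triple:
  assumes "\<rho> \<in> rots" "(m, w, w') \<in> \<rho>"
  shows "m < n" "w < n" "w' < n" "pm m w < pm m w'"
  using assms expoE by (metis rotsE)+

lemma exposed_dom_passed:
  assumes M: "stab M" "stab M'" and \<rho>: "expo M \<rho>" and dom: "dom M M'"
    and start: "(m0, w0, w1) \<in> \<rho>" "pm m0 w0 < man_rank M' m0" and mem: "(m, w, w') \<in> \<rho>"
  shows "pm m w' \<le> man_rank M' m"
proof -
  \<comment> \<open>A man who has left \<open>b\<close> cannot stop strictly before
    \<open>c\<close>: a woman in between does not want him in place of her husband in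
    \<open>M\<close>, and women only improve on the way to \<open>M'\<close>.\<close>
  have jump: "pm a c \<le> man_rank M' a" if abc: "(a, b, c) \<in> \<rho>" "pm a b < man_rank M' a" for a b c
  proof (rule ccontr)
    note e = expoE[OF \<rho> M(1) abc(1)]
    let ?v = "wife M' a"
    have v: "?v < n" "husb M' ?v = a" using M e(1) by simp_all
    assume "\<not> pm a c \<le> man_rank M' a"
    then have "woman_rank M ?v \<le> pw ?v a" using e(8)[OF v(1)] abc(2) by simp
    moreover have "pw ?v a \<le> woman_rank M ?v" using woman_dom[OF M dom v(1)] v(2) by simp
    ultimately have "husb M ?v = a"
      using pw_inj[OF v(1) husb_lt[OF M(1) v(1)] e(1)] by simp
    then have "?v = b" using wife_husb[OF M(1) v(1)] e(4) by simp
    then show False using abc(2) by simp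
  qed
  from \<rho> start(1) mem have "pm m w < man_rank M' m"
  proof (induction rule: expo_cyclic_induct)
    case start
    then show ?case using assms(6) by simp
  next
    case (step a b c d e)
    note ea = expoE[OF \<rho> M(1) step(1)] and ed = expoE[OF \<rho> M(1) step(2)]
    have "pm d c \<le> man_rank M' d" using dom ed(1,4) unfolding dom_def by metis
    \<comment> \<open>If \<open>d\<close> still had \<open>c\<close>, then \<open>a\<close> would be
      strictly beyond \<open>c\<close>, although \<open>c\<close> prefers him to \<open>d\<close>: a
      blocking pair of \<open>M'\<close>.\<close>
    moreover have "wife M' d \<noteq> c"
    proof
      assume c: "wife M' d = c"
      have "a \<noteq> d" using ea(4,6) ed(4) by auto
      then have "wife M' a \<noteq> c" using wife_inj[OF M(2) ea(1) ed(1)] c by auto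
      then have "pm a c < man_rank M' a"
        using jump[OF step(1,3)] pm_inj[OF ea(1,3) wife_lt[OF M(2) ea(1)]] by force
      then have "woman_rank M' c < pw c a" using no_block[OF M(2) ea(1,3)] by simp
      moreover have "husb M' c = d" using husb_wife[OF M(2) ed(1)] c by simp
      ultimately show False using ea(7) ed(5) by simp
    qed
    ultimately show ?case
      using pm_inj[OF ed(1,2) wife_lt[OF M(2) ed(1)]] by force
  qed
  then show ?thesis using jump mem by blast
qed

lemma passed_all:
  assumes M': "stab M'" and \<rho>: "\<rho> \<in> rots" "passed M' \<rho>" "(m, w, w') \<in> \<rho>"
  shows "pm m w' \<le> man_rank M' m"
proof -
  obtain M where M: "stab M" "expo M \<rho>" using rotsE[OF \<rho>(1)] .
  obtain m0 w0 w1 where m0: "(m0, w0, w1) \<in> \<rho>" "pm m0 w0 < man_rank M' m0"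
    using \<rho>(2) unfolding passed_def by blast
  note e = expoE[OF M(2,1) \<rho>(3)] and e0 = expoE[OF M(2,1) m0(1)]
  have "pm m0 w0 < man_rank (meet M M') m0"
    using man_rank_meet[OF M(1) M' e0(1)] m0(2) by simp
  then have "pm m w' \<le> man_rank (meet M M') m"
    using exposed_dom_passed[OF M(1) meet_facts(1)[OF M(1) M'] M(2) dom_meet(1)[OF M(1) M'] m0(1) _ \<rho>(3)]
    by simp
  then show ?thesis using man_rank_meet[OF M(1) M' e(1)] e(4,6) by simp
qed

lemma not_passed: "\<not> passed M \<rho> \<Longrightarrow> (m, w, w') \<in> \<rho> \<Longrightarrow> man_rank M m \<le> pm m w"
  unfolding passed_def by (meson not_le)

lemma passed_mono:
  assumes "\<rho> \<in> rots" "dom M M'" "passed M \<rho>"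
  shows "passed M' \<rho>"
  using assms rots_triple(1)[OF assms(1)] unfolding passed_def dom_def by (meson order_less_le_trans)

lemma expo_not_passed: "stab M \<Longrightarrow> expo M \<rho> \<Longrightarrow> \<not> passed M \<rho>"
  unfolding passed_def using expoE(4) by (metis less_irrefl)

text \<open>Every woman of the cycle is the target of its preceding man, so the new partner map is
  onto and hence injective. Women only improve, so a blocking pair cannot block \<open>M\<close>
  already; its woman would lie strictly between the man's old and new wife, against the choice of
  his next woman.\<close>

lemma eliminate_facts:
  assumes M: "stab M" and \<rho>: "expo M \<rho>"
  shows "stab (eliminate M \<rho>)"
    and "\<And>m w w'. (m, w, w') \<in> \<rho> \<Longrightarrow> wife (eliminate M \<rho>) m = w'"
    and "\<And>m. m < n \<Longrightarrow> (\<And>w w'. (m, w, w') \<notin> \<rho>) \<Longrightarrow> wife (eliminate M \<rho>) m = wife M m"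
proof -
  define f where "f m = (if \<exists>w w'. (m, w, w') \<in> \<rho> then THE w'. \<exists>w. (m, w, w') \<in> \<rho> else wife M m)" for m
  have f1: "f m = w'" if "(m, w, w') \<in> \<rho>" for m w w'
  proof -
    have "(THE w'. \<exists>w. (m, w, w') \<in> \<rho>) = w'"
      using that expo_functional(2)[OF \<rho> \<rho> M] by (intro the_equality) blast+
    then show ?thesis using that unfolding f_def by auto
  qed
  have f2: "f m = wife M m" if "\<And>w w'. (m, w, w') \<notin> \<rho>" for m
    using that unfolding f_def by simp
  have ran: "f m < n" if "m < n" for m
  proof (cases "\<exists>w w'. (m, w, w') \<in> \<rho>")
    case True
    then show ?thesis using f1 expoE(3)[OF \<rho> M] by metis
  next
    case False
    then show ?thesis using f2[of m] that M by simp
  qed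
  have "{..<n} \<subseteq> f ` {..<n}"
  proof
    fix w assume "w \<in> {..<n}"
    then have w: "w < n" by simp
    show "w \<in> f ` {..<n}"
    proof (cases "\<exists>v v'. (husb M w, v, v') \<in> \<rho>")
      case True
      then obtain v' where "(husb M w, w, v') \<in> \<rho>"
        using expoE(4)[OF \<rho> M] wife_husb[OF M w] by metis
      then obtain m' v where "(m', v, w) \<in> \<rho>" using expo_pred[OF \<rho>] by blast
      then show ?thesis using f1 expoE(1)[OF \<rho> M] by (metis image_eqI lessThan_iff)
    next
      case False
      then have "f (husb M w) = w" using f2[of "husb M w"] M w by simp
      then show ?thesis using husb_lt[OF M w] by (metis image_eqI lessThan_iff)
    qed
  qed
  then have inj: "inj_on f {..<n}" by (intro finite_surj_inj) auto
  have g: "eliminate M \<rho> = graph_on n f"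
  proof (rule set_eqI, clarify)
    fix m v
    have *: "(m, v) \<in> eliminate M \<rho> \<longleftrightarrow> ((m, v) \<in> M \<and> (\<forall>w'. (m, v, w') \<notin> \<rho>)) \<or> (\<exists>w. (m, w, v) \<in> \<rho>)"
      unfolding eliminate_def by auto
    show "(m, v) \<in> eliminate M \<rho> \<longleftrightarrow> (m, v) \<in> graph_on n f"
    proof (cases "\<exists>w w'. (m, w, w') \<in> \<rho>")
      case True
      then obtain w w' where t: "(m, w, w') \<in> \<rho>" by blast
      note e = expoE[OF \<rho> M t]
      have "(m, v) \<in> M \<Longrightarrow> v = w" using pair_wife[OF M, of m v] e(4) by simp
      then have "(m, v) \<in> eliminate M \<rho> \<longleftrightarrow> v = w'"
        unfolding * using t expo_functional(2)[OF \<rho> \<rho> M t] by blast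
      then show ?thesis unfolding graph_on_def using f1[OF t] e(1) by auto
    next
      case False
      then have "(m, v) \<in> eliminate M \<rho> \<longleftrightarrow> (m, v) \<in> M" unfolding * by blast
      then show ?thesis using pair_wife[OF M, of m v] f2[of m] False unfolding graph_on_def by auto
    qed
  qed
  note p = perfect_graph(2)[OF inj ran]
  show "\<And>m w w'. (m, w, w') \<in> \<rho> \<Longrightarrow> wife (eliminate M \<rho>) m = w'"
    unfolding g using p f1 expoE(1)[OF \<rho> M] by metis
  show "\<And>m. m < n \<Longrightarrow> (\<And>w w'. (m, w, w') \<notin> \<rho>) \<Longrightarrow> wife (eliminate M \<rho>) m = wife M m"
    unfolding g using p f2 by metis
  show "stab (eliminate M \<rho>)" unfolding g
  proof (rule stable_graphI[OF inj ran])
    fix m h assume a: "m < n" "h < n" "pm m (f h) < pm m (f m)" "pw (f h) m < pw (f h) h"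
    have "pw (f h) h \<le> woman_rank M (f h)"
    proof (cases "\<exists>w w'. (h, w, w') \<in> \<rho>")
      case True
      then show ?thesis using f1 expoE(7)[OF \<rho> M] by (metis less_imp_le)
    next
      case False
      then show ?thesis using f2[of h] M a(2) by simp
    qed
    then have b: "pw (f h) m < woman_rank M (f h)" using a(4) by simp
    have fh: "f h < n" using ran a(2) .
    have c: "man_rank M m < pm m (f h)" using no_block_woman[OF M a(1) fh b] .
    show False
    proof (cases "\<exists>w w'. (m, w, w') \<in> \<rho>")
      case True
      then obtain w w' where t: "(m, w, w') \<in> \<rho>" by blast
      show False using expoE(8)[OF \<rho> M t fh] expoE(4)[OF \<rho> M t] f1[OF t] a(3) b c by simp
    next
      case False
      then show False using f2[of m] a(3) c by simp
    qed
  qed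
qed

lemma dom_eliminate:
  assumes "stab M" "expo M \<rho>"
  shows "dom M (eliminate M \<rho>)"
  unfolding dom_def
proof (intro allI impI)
  fix m assume "m < n"
  then show "man_rank M m \<le> man_rank (eliminate M \<rho>) m"
    using eliminate_facts(2,3)[OF assms] expoE(4,6)[OF assms(2,1)]
    by (cases "\<exists>w w'. (m, w, w') \<in> \<rho>") (metis less_imp_le, metis le_refl)
qed

lemma eliminate_dom:
  assumes "stab M" "stab M'" "expo M \<rho>" "dom M M'" "passed M' \<rho>"
  shows "dom (eliminate M \<rho>) M'"
  unfolding dom_def
proof (intro allI impI)
  fix m assume m: "m < n"
  have "pm m w' \<le> man_rank M' m" if "(m, w, w') \<in> \<rho>" for w w'
    using passed_all[OF assms(2) rotsI[OF assms(1,3)] assms(5) that] .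
  then show "man_rank (eliminate M \<rho>) m \<le> man_rank M' m"
    using m assms(4) eliminate_facts(2,3)[OF assms(1,3)] unfolding dom_def
    by (cases "\<exists>w w'. (m, w, w') \<in> \<rho>") (metis, metis)
qed

lemma passed_eliminate: "stab M \<Longrightarrow> expo M \<rho> \<Longrightarrow> passed (eliminate M \<rho>) \<rho>"
  using expo_nonempty[of M \<rho>] eliminate_facts(2)[of M \<rho>] expoE(6)[of M \<rho>]
  unfolding passed_def by metis

end

section \<open>Existence of exposed rotations and their survival in joins and meets\<close>

lemma finite_self_map_cycle:
  assumes "finite D" "D \<noteq> {}" "g ` D \<subseteq> D"
  obtains x p where "x \<in> D" "0 < p" "(g ^^ p) x = x" "inj_on (\<lambda>i. (g ^^ i) x) {..<p}"
proof -
  have pow: "(g ^^ i) x \<in> D" if "x \<in> D" for i x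
    using that assms(3) by (induction i) auto
  have ret: "(g ^^ (j - i)) ((g ^^ i) x) = (g ^^ i) x" if "i < j" "(g ^^ i) x = (g ^^ j) x" for i j x
  proof -
    have "(g ^^ (j - i)) ((g ^^ i) x) = (g ^^ (j - i + i)) x" by (simp only: funpow_add o_apply)
    then show ?thesis using that by simp
  qed
  define Q where "Q p \<longleftrightarrow> 0 < p \<and> (\<exists>x\<in>D. (g ^^ p) x = x)" for p
  obtain x0 where x0: "x0 \<in> D" using assms(2) by blast
  have "\<not> inj (\<lambda>i. (g ^^ i) x0)"
  proof
    assume "inj (\<lambda>i. (g ^^ i) x0)"
    then have "infinite (range (\<lambda>i. (g ^^ i) x0))" using finite_imageD by blast
    moreover have "range (\<lambda>i. (g ^^ i) x0) \<subseteq> D" using pow[OF x0] by blast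
    ultimately show False using assms(1) finite_subset by blast
  qed
  then obtain i j where "i < j" "(g ^^ i) x0 = (g ^^ j) x0"
    unfolding inj_def by (metis linorder_neqE_nat)
  then have "Q (j - i)" unfolding Q_def using ret pow[OF x0] by (meson zero_less_diff)
  \<comment> \<open>The least period of any point: two equal iterates below \<open>p\<close> would
    give a point with a smaller one.\<close>
  define p where "p = (LEAST p. Q p)"
  have "Q p" unfolding p_def using \<open>Q (j - i)\<close> by (rule LeastI)
  then obtain x where x: "x \<in> D" "(g ^^ p) x = x" "0 < p" unfolding Q_def by blast
  have no: "\<not> (i < j \<and> j < p \<and> (g ^^ i) x = (g ^^ j) x)" for i j
  proof
    assume a: "i < j \<and> j < p \<and> (g ^^ i) x = (g ^^ j) x"
    then have "Q (j - i)" unfolding Q_def using ret pow[OF x(1)] by (meson zero_less_diff)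
    then have "p \<le> j - i" unfolding p_def by (rule Least_le)
    then show False using a by linarith
  qed
  have "inj_on (\<lambda>i. (g ^^ i) x) {..<p}"
    by (rule inj_onI) (metis lessThan_iff linorder_neqE_nat no)
  then show thesis using that x by blast
qed

context sm
begin

text \<open>Send each man who is worse off in \<open>M'\<close> to the husband, in \<open>M\<close>,
  of his next woman. A cycle of this map is an exposed rotation. The next woman exists and comes no
  later than the wife in \<open>M'\<close>, since by \<open>opposite_snd\<close> that wife is a
  candidate.\<close>

lemma ex_exposed_toward:
  assumes M: "stab M" "stab M'" and dom: "dom M M'" and ne: "M \<noteq> M'"
  shows "\<exists>\<rho>. expo M \<rho> \<and> passed M' \<rho>"
proof -
  define D where "D = {m. m < n \<and> man_rank M m < man_rank M' m}"
  have "\<exists>w. next_woman n pm pw M m w \<and> pm m w \<le> man_rank M' m" if "m \<in> D" for m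
  proof -
    have m: "m < n" "man_rank M m < man_rank M' m" using that D_def by auto
    define Q where "Q v \<longleftrightarrow> v < n \<and> man_rank M m < pm m v \<and> pw v m < woman_rank M v" for v
    have "Q (wife M' m)"
      unfolding Q_def using m opposite_snd[OF M m] wife_lt[OF M(2) m(1)] by simp
    then obtain w where w: "Q w" "\<And>v. Q v \<Longrightarrow> pm m w \<le> pm m v"
      using ex_has_least_nat[of Q "wife M' m" "pm m"] by blast
    have "next_woman n pm pw M m w"
      unfolding next_woman_iff[OF M(1)] using m w unfolding Q_def by (meson not_le)
    then show ?thesis using w \<open>Q (wife M' m)\<close> by blast
  qed
  then obtain s where s: "\<And>m. m \<in> D \<Longrightarrow> next_woman n pm pw M m (s m) \<and> pm m (s m) \<le> man_rank M' m"
    by metis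
  define g where "g m = husb M (s m)" for m
  have sn: "s m < n" "man_rank M m < pm m (s m)" "pw (s m) m < woman_rank M (s m)" if "m \<in> D" for m
    using s[OF that] unfolding next_woman_iff[OF M(1)] by auto
  have gs: "wife M (g m) = s m" if "m \<in> D" for m
    using M(1) sn(1)[OF that] unfolding g_def by simp
  have gne: "g m \<noteq> m" if "m \<in> D" for m
    using gs[OF that] sn(2)[OF that] by auto
  have gD: "g ` D \<subseteq> D"
  proof (rule image_subsetI)
    fix m assume mD: "m \<in> D"
    then have m: "m < n" using D_def by auto
    have q: "g m < n" unfolding g_def using M(1) sn(1)[OF mD] by simp
    \<comment> \<open>If \<open>g m\<close> kept this woman in \<open>M'\<close>, then
      \<open>m\<close> would be beyond her there and would block \<open>M'\<close> with her. So
      \<open>g m\<close> is worse off too.\<close>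
    have "wife M' (g m) \<noteq> s m"
    proof
      assume w: "wife M' (g m) = s m"
      then have "wife M' m \<noteq> s m" using wife_inj[OF M(2) q m] gne[OF mD] by auto
      then have "pm m (s m) < man_rank M' m"
        using s[OF mD] pm_inj[OF m sn(1)[OF mD] wife_lt[OF M(2) m]] by force
      then have "woman_rank M' (s m) < pw (s m) m" using no_block[OF M(2) m sn(1)[OF mD]] by simp
      moreover have "husb M' (s m) = g m" using husb_wife[OF M(2) q] w by simp
      ultimately show False using sn(3)[OF mD] g_def by simp
    qed
    then have "man_rank M (g m) < man_rank M' (g m)"
      using man_rank_less[OF M q] gs[OF mD] dom q unfolding dom_def by auto
    then show "g m \<in> D" using q D_def by simp
  qed
  have "D \<noteq> {}"
  proof
    assume "D = {}"
    then have "wife M m = wife M' m" if "m < n" for m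
      using that man_rank_less[OF M that] dom unfolding D_def dom_def by auto
    then show False using stable_eqI[OF M] ne by blast
  qed
  moreover have "finite D" unfolding D_def by simp
  ultimately obtain x p where x: "x \<in> D" "0 < p" "(g ^^ p) x = x" "inj_on (\<lambda>i. (g ^^ i) x) {..<p}"
    using finite_self_map_cycle[OF _ _ gD] by blast
  have "p \<noteq> 1" using gne[OF x(1)] x(3) by auto
  then have p2: "2 \<le> p" using x(2) by simp
  have pow: "(g ^^ i) x \<in> D" for i using x(1) gD by (induction i) auto
  define ps where "ps = map (\<lambda>i. ((g ^^ i) x, wife M ((g ^^ i) x))) [0..<p]"
  have len: "length ps = p" unfolding ps_def by simp
  have nth: "ps ! i = ((g ^^ i) x, wife M ((g ^^ i) x))" if "i < p" for i
    using that unfolding ps_def by simp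
  have nxt: "snd (ps ! ((i + 1) mod p)) = s ((g ^^ i) x)" if "i < p" for i
  proof -
    have "(g ^^ ((i + 1) mod p)) x = (g ^^ (i + 1)) x" using funpow_mod_eq[OF x(3)] .
    then show ?thesis using nth[of "(i + 1) mod p"] x(2) gs[OF pow[of i]] by simp
  qed
  define \<rho> where "\<rho> = {(fst (ps ! i), snd (ps ! i), snd (ps ! ((i + 1) mod length ps))) | i. i < length ps}"
  have "distinct (map fst ps)"
    unfolding ps_def using x(4) by (simp add: distinct_map o_def atLeast0LessThan)
  moreover have "ps ! i \<in> M \<and> next_woman n pm pw M (fst (ps ! i)) (snd (ps ! ((i + 1) mod length ps)))"
    if "i < length ps" for i
    using that nth nxt s[OF pow[of i]] pow[of i] pair_wife[OF M(1)] unfolding len D_def by simp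
  ultimately have "expo M \<rho>"
    unfolding exposed_def \<rho>_def using p2 len by blast
  moreover have "passed M' \<rho>"
  proof -
    have "(x, wife M x, snd (ps ! ((0 + 1) mod p))) \<in> \<rho>"
      unfolding \<rho>_def len using nth[OF x(2)] x(2) by force
    then show ?thesis unfolding passed_def using x(1) D_def by blast
  qed
  ultimately show ?thesis by blast
qed

text \<open>The pairs of \<open>\<rho>\<close> are the same in all three matchings. A woman skipped
  by a man of \<open>\<rho>\<close> rejects him in favour of either of her two husbands, and one of
  them is her husband in the join.\<close>

lemma expo_join:
  assumes M: "stab M" "stab M'" and \<rho>: "expo M \<rho>" "expo M' \<rho>"
  shows "expo (join M M') \<rho>"
proof (rule expo_transfer[OF \<rho>(1)])
  note J = join_facts[OF M]
  have wJ: "wife (join M M') m = w" if "(m, w, w') \<in> \<rho>" for m w w'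
    using J(2) expoE(1,4)[OF \<rho>(1) M(1) that] expoE(4)[OF \<rho>(2) M(2) that] by simp
  fix m w w' assume t: "(m, w, w') \<in> \<rho>"
  note e = expoE[OF \<rho>(1) M(1) t] and e' = expoE[OF \<rho>(2) M(2) t]
  obtain d x where d: "(d, w', x) \<in> \<rho>" using expo_succ[OF \<rho>(1) t] by blast
  have "husb (join M M') w' = d" "husb M w' = d"
    using husb_wife[OF J(1), of d] wJ[OF d] expoE(1,5)[OF \<rho>(1) M(1) d] by simp_all
  then have "pw w' m < woman_rank (join M M') w'" using e(7) by simp
  moreover have "woman_rank (join M M') v \<le> pw v m"
    if v: "v < n" "pm m w < pm m v" "pm m v < pm m w'" for v
  proof -
    define h where "h = husb (join M M') v"
    have h: "h < n" "wife (join M M') h = v" using v(1) J(1) unfolding h_def by simp_all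
    then have "wife M h = v \<or> wife M' h = v" using J(2) by (auto split: if_splits)
    then have "husb M v = h \<or> husb M' v = h" using h(1) M by auto
    then show ?thesis using e(8)[OF v] e'(8)[OF v] unfolding h_def by auto
  qed
  ultimately show "(m, w) \<in> join M M' \<and> next_woman n pm pw (join M M') m w'"
    unfolding next_woman_iff[OF J(1)] pair_wife[OF J(1)] using e wJ[OF t] by simp
qed

text \<open>As \<open>\<rho>\<close> is not passed in \<open>M'\<close>, its men keep their wives
  from \<open>M\<close> in the meet, and the skipped women only improve.\<close>

lemma expo_meet:
  assumes M: "stab M" "stab M'" and \<rho>: "expo M \<rho>" "\<not> passed M' \<rho>"
  shows "expo (meet M M') \<rho>"
proof (rule expo_transfer[OF \<rho>(1)])
  note J = meet_facts[OF M]
  have wJ: "wife (meet M M') m = w" if "(m, w, w') \<in> \<rho>" for m w w'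
    using J(2) expoE(1,4)[OF \<rho>(1) M(1) that] not_passed[OF \<rho>(2) that] by simp
  fix m w w' assume t: "(m, w, w') \<in> \<rho>"
  note e = expoE[OF \<rho>(1) M(1) t]
  obtain d x where d: "(d, w', x) \<in> \<rho>" using expo_succ[OF \<rho>(1) t] by blast
  have "husb (meet M M') w' = d" "husb M w' = d"
    using husb_wife[OF J(1), of d] wJ[OF d] expoE(1,5)[OF \<rho>(1) M(1) d] by simp_all
  then have "pw w' m < woman_rank (meet M M') w'" using e(7) by simp
  moreover have "woman_rank (meet M M') v \<le> pw v m"
    if v: "v < n" "pm m w < pm m v" "pm m v < pm m w'" for v
    using e(8)[OF v] woman_dom[OF M(1) J(1) dom_meet(1)[OF M] v(1)] by simp
  ultimately show "(m, w) \<in> meet M M' \<and> next_woman n pm pw (meet M M') m w'"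
    unfolding next_woman_iff[OF J(1)] pair_wife[OF J(1)] using e wJ[OF t] by simp
qed

lemma meet_commute:
  assumes "stab M" "stab M'"
  shows "meet M M' = meet M' M"
  using man_rank_meet[OF assms] man_rank_meet[OF assms(2,1)]
    dom_antisym[OF meet_facts(1)[OF assms] meet_facts(1)[OF assms(2,1)]]
  unfolding dom_def by (simp add: max.commute)

text \<open>The rotation survives in the meet of the two exposing matchings, where it is determined by
  any one of its men.\<close>

lemma rots_eq:
  assumes \<rho>: "\<rho> \<in> rots" "\<pi> \<in> rots" and t: "(m, w, a) \<in> \<rho>" "(m, w, b) \<in> \<pi>"
  shows "\<rho> = \<pi>"
proof -
  obtain M where M: "stab M" "expo M \<rho>" using rotsE[OF \<rho>(1)] .
  obtain M' where M': "stab M'" "expo M' \<pi>" using rotsE[OF \<rho>(2)] .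
  note e = expoE[OF M(2,1) t(1)] and e' = expoE[OF M'(2,1) t(2)]
  have "\<not> passed M' \<rho>" using passed_all[OF M'(1) \<rho>(1) _ t(1)] e(6) e'(4) by auto
  then have 1: "expo (meet M M') \<rho>" using expo_meet[OF M(1) M'(1) M(2)] by blast
  have "\<not> passed M \<pi>" using passed_all[OF M(1) \<rho>(2) _ t(2)] e'(6) e(4) by auto
  then have "expo (meet M M') \<pi>"
    using expo_meet[OF M'(1) M(1) M'(2)] meet_commute[OF M(1) M'(1)] by simp
  then show ?thesis using expo_eq[OF 1 _ meet_facts(1)[OF M(1) M'(1)] t] by blast
qed

text \<open>A man of \<open>\<rho>\<close> moves in the single step \<open>\<sigma>\<close> from
  \<open>w\<close> or earlier to \<open>w'\<close> or later. Were he to start before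
  \<open>w\<close>, a matching exposing \<open>\<rho>\<close> would have passed
  \<open>\<sigma>\<close> and would put him at \<open>w'\<close> or later, yet he has
  \<open>w\<close> there. So both rotations take him from \<open>w\<close>.\<close>

lemma eliminate_newly_passed:
  assumes S: "stab S" "expo S \<sigma>" and \<rho>: "\<rho> \<in> rots" "\<not> passed S \<rho>" "passed (eliminate S \<sigma>) \<rho>"
  shows "\<sigma> = \<rho>"
proof -
  obtain M where M: "stab M" "expo M \<rho>" using rotsE[OF \<rho>(1)] .
  obtain m w w' where t: "(m, w, w') \<in> \<rho>" using expo_nonempty[OF M(2)] by blast
  note e = expoE[OF M(2,1) t] and el = eliminate_facts[OF S]
  have le: "man_rank S m \<le> pm m w" using not_passed[OF \<rho>(2) t] .
  have ge: "pm m w' \<le> man_rank (eliminate S \<sigma>) m" using passed_all[OF el(1) \<rho>(1,3) t] .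
  obtain a b where ab: "(m, a, b) \<in> \<sigma>"
    using el(3)[OF e(1)] le ge e(6) by fastforce
  note f = expoE[OF S(2,1) ab]
  have "a = w"
  proof (rule ccontr)
    assume "a \<noteq> w"
    then have "pm m a < man_rank M m" using le f(4) pm_inj[OF f(1,2) e(2)] e(4) by force
    then have "passed M \<sigma>" unfolding passed_def using ab by blast
    from passed_all[OF M(1) rotsI[OF S] this ab] show False
      using e(4,6) ge el(2)[OF ab] by simp
  qed
  then show ?thesis using rots_eq[OF rotsI[OF S] \<rho>(1)] ab t by blast
qed

subsection \<open>Elimination sequences and the rotation poset\<close>

text \<open>A potential that grows strictly along \<open>dom\<close>; it yields extremal matchings
  and the termination of eliminations.\<close>

definition cost :: "(nat \<times> nat) set \<Rightarrow> nat" where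
  "cost M = (\<Sum>m<n. man_rank M m)"

lemma cost_less:
  assumes "stab M" "stab M'" "dom M M'" "M \<noteq> M'"
  shows "cost M < cost M'"
proof -
  obtain m where m: "m < n" "wife M m \<noteq> wife M' m" using stable_eqI[OF assms(1,2)] assms(4) by blast
  then have "man_rank M m < man_rank M' m"
    using man_rank_less[OF assms(1,2)] assms(3) unfolding dom_def by blast
  then show ?thesis
    unfolding cost_def using assms(3) m(1) unfolding dom_def
    by (intro sum_strict_mono_ex1) auto
qed

lemma cost_le: "stab M \<Longrightarrow> cost M \<le> n * n"
proof -
  assume M: "stab M"
  have "man_rank M m \<le> n" if "m \<in> {..<n}" for m
  proof -
    have "bij_betw (pm m) {..<n} {..<n}" using that inst unfolding sm_instance_def by simp
    then have "man_rank M m \<in> {..<n}" using bij_betwE wife_lt[OF M] that by blast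
    then show ?thesis by simp
  qed
  then show ?thesis unfolding cost_def using sum_bounded_above[of "{..<n}" "man_rank M" n] by simp
qed

text \<open>A matching of least cost in the family equals its join with any other member, hence
  dominates it.\<close>

lemma ex_man_best:
  assumes "P M0" and st: "\<And>M. P M \<Longrightarrow> stab M"
    and cl: "\<And>M M'. P M \<Longrightarrow> P M' \<Longrightarrow> P (join M M')"
  shows "\<exists>T. P T \<and> (\<forall>M. P M \<longrightarrow> dom T M)"
proof -
  obtain T where T: "P T" "\<And>M. P M \<Longrightarrow> cost T \<le> cost M"
    using ex_has_least_nat[of P M0 cost] assms(1) by blast
  have "dom T M" if "P M" for M
  proof -
    note s = st[OF T(1)] st[OF that]
    have "join T M = T"
      using cost_less[OF join_facts(1)[OF s] s(1) dom_join(1)[OF s]] T(2)[OF cl[OF T(1) that]]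
      by linarith
    then show ?thesis using dom_join(2)[OF s] by simp
  qed
  then show ?thesis using T(1) by blast
qed

lemma ex_man_worst:
  assumes "P M0" and st: "\<And>M. P M \<Longrightarrow> stab M"
    and cl: "\<And>M M'. P M \<Longrightarrow> P M' \<Longrightarrow> P (meet M M')"
  shows "\<exists>T. P T \<and> (\<forall>M. P M \<longrightarrow> dom M T)"
proof -
  have "\<exists>T. P T \<and> (\<forall>M. P M \<longrightarrow> cost M \<le> cost T)"
    using assms(1) cost_le[OF st]
    by (intro ex_has_greatest_nat[of P M0 cost "Suc (n * n)"]) (auto simp: less_Suc_eq_le)
  then obtain T where T: "P T" "\<And>M. P M \<Longrightarrow> cost M \<le> cost T" by blast
  have "dom M T" if "P M" for M
  proof -
    note s = st[OF T(1)] st[OF that]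
    have "T = meet T M"
      using cost_less[OF s(1) meet_facts(1)[OF s] dom_meet(1)[OF s]] T(2)[OF cl[OF T(1) that]]
      by linarith
    then show ?thesis using dom_meet(2)[OF s] by argo
  qed
  then show ?thesis using T(1) by blast
qed

lemma man_optimal_iff: "man_optimal n pm pw M0 \<longleftrightarrow> stab M0 \<and> (\<forall>M. stab M \<longrightarrow> dom M0 M)"
proof -
  have "(\<forall>m w w'. (m, w) \<in> M0 \<longrightarrow> (m, w') \<in> M \<longrightarrow> pm m w \<le> pm m w') \<longleftrightarrow> dom M0 M"
    if "stab M0" "stab M" for M
    unfolding dom_def pair_wife[OF that(1)] pair_wife[OF that(2)] by auto
  then show ?thesis unfolding man_optimal_def by blast
qed

lemma ex_man_optimal: "stab M \<Longrightarrow> \<exists>M0. man_optimal n pm pw M0"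
  unfolding man_optimal_iff using ex_man_best[of stab M] join_facts(1) by blast

lemma elim_seq_stable: "elim_seq n pm pw M0 rs M \<Longrightarrow> stab M0 \<Longrightarrow> stab M"
  by (induction rule: elim_seq.induct) (auto intro: eliminate_facts(1))

text \<open>The man-optimal matching has passed nothing, because it dominates a matching that
  exposes \<open>\<rho>\<close>; each elimination adds exactly the eliminated rotation.\<close>

lemma elim_seq_passed:
  assumes "elim_seq n pm pw M0 rs M" "man_optimal n pm pw M0" "\<rho> \<in> rots"
  shows "\<rho> \<in> set rs \<longleftrightarrow> passed M \<rho>"
  using assms(1)
proof (induction rule: elim_seq.induct)
  case Nil
  obtain M where M: "stab M" "expo M \<rho>" using rotsE[OF assms(3)] .
  then have "dom M0 M" using assms(2) unfolding man_optimal_iff by blast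
  then show ?case using passed_mono[OF assms(3)] expo_not_passed[OF M] by auto
next
  case (Snoc rs M \<sigma>)
  have S: "stab M" "expo M \<sigma>"
    using elim_seq_stable[OF Snoc(1)] assms(2) Snoc(2) unfolding man_optimal_iff by auto
  have "passed (eliminate M \<sigma>) \<rho> \<longleftrightarrow> passed M \<rho> \<or> \<sigma> = \<rho>"
    using eliminate_newly_passed[OF S assms(3)] passed_eliminate[OF S]
      passed_mono[OF assms(3) dom_eliminate[OF S]] by blast
  then show ?case using Snoc.IH by auto
qed

lemma elim_seq_extend:
  assumes "stab M'" "stab M0"
  shows "elim_seq n pm pw M0 rs M \<Longrightarrow> dom M M' \<Longrightarrow> \<exists>rs'. elim_seq n pm pw M0 rs' M'"
proof (induction "cost M' - cost M" arbitrary: M rs rule: less_induct)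
  case less
  have M: "stab M" using elim_seq_stable[OF less(2) assms(2)] .
  show ?case
  proof (cases "M = M'")
    case True
    then show ?thesis using less(2) by blast
  next
    case False
    then obtain \<rho> where \<rho>: "expo M \<rho>" "passed M' \<rho>"
      using ex_exposed_toward[OF M assms(1) less(3)] by blast
    let ?N = "eliminate M \<rho>"
    have N: "stab ?N" "dom ?N M'" "dom M ?N" "M \<noteq> ?N"
      using eliminate_facts(1)[OF M \<rho>(1)] eliminate_dom[OF M assms(1) \<rho>(1) less(3) \<rho>(2)]
        dom_eliminate[OF M \<rho>(1)] passed_eliminate[OF M \<rho>(1)] expo_not_passed[OF M \<rho>(1)] by auto
    have "cost M' - cost ?N < cost M' - cost M"
      using cost_less[OF M N(1,3,4)] cost_less[OF M assms(1) less(3) False] by linarith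
    then show ?thesis using less(1)[OF _ elim_seq.Snoc[OF less(2) \<rho>(1)] N(2)] by blast
  qed
qed

lemma elim_seq_reaches:
  assumes "man_optimal n pm pw M0" "stab M"
  shows "\<exists>rs. elim_seq n pm pw M0 rs M"
  using elim_seq_extend[OF assms(2) _ elim_seq.Nil] assms unfolding man_optimal_iff by blast

lemma elim_seq_takeWhile:
  "elim_seq n pm pw M0 rs M \<Longrightarrow> \<pi> \<in> set rs \<Longrightarrow>
    \<exists>M'. elim_seq n pm pw M0 (takeWhile (\<lambda>x. x \<noteq> \<pi>) rs) M' \<and> expo M' \<pi>"
proof (induction rule: elim_seq.induct)
  case (Snoc rs M \<sigma>)
  show ?case
  proof (cases "\<pi> \<in> set rs")
    case True
    then show ?thesis using Snoc.IH by (simp add: takeWhile_append1)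
  next
    case False
    then have "takeWhile (\<lambda>x. x \<noteq> \<pi>) (rs @ [\<sigma>]) = rs" "\<sigma> = \<pi>"
      using Snoc.prems by (auto simp: takeWhile_append)
    then show ?thesis using Snoc by auto
  qed
qed simp

text \<open>The part of a sequence before \<open>\<pi>\<close> ends in a matching exposing
  \<open>\<pi>\<close>, and every such matching is reached from the man-optimal one by a sequence to
  which \<open>\<pi>\<close> can be appended.\<close>

lemma rot_lt_iff:
  "rot_lt n pm pw \<rho> \<pi> \<longleftrightarrow>
    \<rho> \<in> rots \<and> \<pi> \<in> rots \<and> \<rho> \<noteq> \<pi> \<and> (\<forall>M. stab M \<longrightarrow> expo M \<pi> \<longrightarrow> passed M \<rho>)"
proof (cases "\<rho> \<in> rots \<and> \<pi> \<in> rots \<and> \<rho> \<noteq> \<pi>")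
  case False
  then show ?thesis unfolding rot_lt_def rot_le_def by auto
next
  case True
  have "(\<forall>M0 rs M. man_optimal n pm pw M0 \<longrightarrow> elim_seq n pm pw M0 rs M \<longrightarrow> \<pi> \<in> set rs \<longrightarrow>
      \<rho> \<in> set (takeWhile (\<lambda>x. x \<noteq> \<pi>) rs)) \<longleftrightarrow> (\<forall>M. stab M \<longrightarrow> expo M \<pi> \<longrightarrow> passed M \<rho>)" (is "?L \<longleftrightarrow> ?R")
  proof
    assume L: ?L
    show ?R
    proof (intro allI impI)
      fix M assume M: "stab M" "expo M \<pi>"
      obtain M0 where M0: "man_optimal n pm pw M0" using ex_man_optimal[OF M(1)] by blast
      obtain rs where rs: "elim_seq n pm pw M0 rs M" using elim_seq_reaches[OF M0 M(1)] by blast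
      have "\<pi> \<notin> set rs" using elim_seq_passed[OF rs M0] expo_not_passed[OF M] True by blast
      then have "takeWhile (\<lambda>x. x \<noteq> \<pi>) (rs @ [\<pi>]) = rs" by (auto simp: takeWhile_append)
      moreover have "\<rho> \<in> set (takeWhile (\<lambda>x. x \<noteq> \<pi>) (rs @ [\<pi>]))"
        using L M0 elim_seq.Snoc[OF rs M(2)] by (meson in_set_conv_decomp)
      ultimately have "\<rho> \<in> set rs" by simp
      then show "passed M \<rho>" using elim_seq_passed[OF rs M0] True by blast
    qed
  next
    assume R: ?R
    show ?L
    proof (intro allI impI)
      fix M0 rs M assume a: "man_optimal n pm pw M0" "elim_seq n pm pw M0 rs M" "\<pi> \<in> set rs"
      obtain M' where M': "elim_seq n pm pw M0 (takeWhile (\<lambda>x. x \<noteq> \<pi>) rs) M'" "expo M' \<pi>"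
        using elim_seq_takeWhile[OF a(2,3)] by blast
      have "stab M'" using elim_seq_stable[OF M'(1)] a(1) unfolding man_optimal_iff by blast
      then show "\<rho> \<in> set (takeWhile (\<lambda>x. x \<noteq> \<pi>) rs)"
        using R M'(2) elim_seq_passed[OF M'(1) a(1)] True by blast
    qed
  qed
  then show ?thesis using True unfolding rot_lt_def rot_le_def by auto
qed

subsection \<open>Covering pairs of rotations\<close>

text \<open>\<open>T\<close> is the man-best matching exposing \<open>\<pi>\<close>, so all rotations leading to \<open>T\<close> are below \<open>\<pi>\<close>.
  \<open>S\<close> is the man-worst matching above \<open>T\<close> that still lacks \<open>\<rho>\<close>: a rotation needed between
  \<open>S\<close> with \<open>\<rho>\<close> eliminated and \<open>T\<close> would lie strictly between \<open>\<rho>\<close> and \<open>\<pi>\<close>.\<close>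

lemma cover_adjacent:
  assumes lt: "rot_lt n pm pw \<rho> \<pi>"
    and cov: "\<not> (\<exists>c. rot_lt n pm pw \<rho> c \<and> rot_lt n pm pw c \<pi>)"
  shows "\<exists>S. stab S \<and> expo S \<rho> \<and> expo (eliminate S \<rho>) \<pi> \<and> \<not> expo S \<pi>"
proof -
  have r: "\<rho> \<in> rots" "\<pi> \<in> rots" and p: "\<And>M. stab M \<Longrightarrow> expo M \<pi> \<Longrightarrow> passed M \<rho>"
    using lt unfolding rot_lt_iff by auto
  obtain M\<^sub>1 where M1: "stab M\<^sub>1" "expo M\<^sub>1 \<pi>" using rotsE[OF r(2)] .
  have "\<exists>T. (stab T \<and> expo T \<pi>) \<and> (\<forall>M. stab M \<and> expo M \<pi> \<longrightarrow> dom T M)"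
    by (rule ex_man_best[of "\<lambda>M. stab M \<and> expo M \<pi>", OF conjI[OF M1]])
      (auto intro: expo_join join_facts(1))
  then obtain T where T: "stab T" "expo T \<pi>" "\<And>M. stab M \<Longrightarrow> expo M \<pi> \<Longrightarrow> dom T M" by blast
  define P where "P M \<longleftrightarrow> stab M \<and> dom M T \<and> \<not> passed M \<rho>" for M
  obtain M0 where M0: "man_optimal n pm pw M0" using ex_man_optimal[OF T(1)] by blast
  have "\<not> passed M0 \<rho>" using elim_seq_passed[OF elim_seq.Nil M0 r(1)] by simp
  then have P0: "P M0" using M0 T(1) unfolding man_optimal_iff P_def by blast
  have Pst: "stab M" if "P M" for M using that P_def by blast
  have Pmeet: "P (meet M M')" if "P M" "P M'" for M M'
  proof -
    have s: "stab M" "stab M'" and d: "dom M T" "dom M' T" and np: "\<not> passed M \<rho>" "\<not> passed M' \<rho>"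
      using that unfolding P_def by auto
    have "dom (meet M M') T" using d man_rank_meet[OF s] unfolding dom_def by simp
    moreover have "\<not> passed (meet M M') \<rho>"
    proof
      assume "passed (meet M M') \<rho>"
      then obtain m w w' where "(m, w, w') \<in> \<rho>" "pm m w < man_rank (meet M M') m"
        unfolding passed_def by blast
      then show False
        using man_rank_meet[OF s rots_triple(1)[OF r(1)]] not_passed[OF np(1)] not_passed[OF np(2)]
        by (metis max_def not_le)
    qed
    ultimately show ?thesis using meet_facts(1)[OF s] unfolding P_def by blast
  qed
  obtain S where PS: "P S" and S_max: "\<And>M. P M \<Longrightarrow> dom M S"
    using ex_man_worst[of P, OF P0 Pst Pmeet] by blast
  have S: "stab S" "dom S T" "\<not> passed S \<rho>" using PS P_def by auto
  have "S \<noteq> T" using p[OF T(1,2)] S(3) by auto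
  then obtain \<sigma> where \<sigma>: "expo S \<sigma>" "passed T \<sigma>" using ex_exposed_toward[OF S(1) T(1) S(2)] by blast
  have E: "stab (eliminate S \<sigma>)" "dom (eliminate S \<sigma>) T"
    using eliminate_facts(1)[OF S(1) \<sigma>(1)] eliminate_dom[OF S(1) T(1) \<sigma>(1) S(2) \<sigma>(2)] by auto
  \<comment> \<open>Otherwise this matching would satisfy \<open>P\<close> and lie strictly beyond
    \<open>S\<close>. So the only step from \<open>S\<close> towards \<open>T\<close> is
    \<open>\<rho>\<close>.\<close>
  have "passed (eliminate S \<sigma>) \<rho>"
  proof (rule ccontr)
    assume "\<not> passed (eliminate S \<sigma>) \<rho>"
    then have "dom (eliminate S \<sigma>) S" using S_max E unfolding P_def by blast
    from passed_mono[OF rotsI[OF S(1) \<sigma>(1)] this passed_eliminate[OF S(1) \<sigma>(1)]]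
    show False using expo_not_passed[OF S(1) \<sigma>(1)] by simp
  qed
  then have "\<sigma> = \<rho>" using eliminate_newly_passed[OF S(1) \<sigma>(1) r(1) S(3)] by simp
  note \<sigma> = \<sigma>[unfolded this] and E = E[unfolded this]
  have "eliminate S \<rho> = T"
  proof (rule ccontr)
    assume "eliminate S \<rho> \<noteq> T"
    then obtain \<tau> where \<tau>: "expo (eliminate S \<rho>) \<tau>" "passed T \<tau>"
      using ex_exposed_toward[OF E(1) T(1) E(2)] by blast
    have \<tau>r: "\<tau> \<in> rots" using rotsI[OF E(1) \<tau>(1)] .
    have np: "\<not> passed (eliminate S \<rho>) \<tau>" using expo_not_passed[OF E(1) \<tau>(1)] .
    then have "\<tau> \<noteq> \<rho>" using passed_eliminate[OF S(1) \<sigma>(1)] by auto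
    have "\<tau> \<noteq> \<pi>" using expo_not_passed[OF T(1,2)] \<tau>(2) by auto
    then have "rot_lt n pm pw \<tau> \<pi>"
      unfolding rot_lt_iff using \<tau>r r(2) passed_mono[OF \<tau>r T(3) \<tau>(2)] by blast
    then have "\<not> rot_lt n pm pw \<rho> \<tau>" using cov by blast
    then obtain M where M: "stab M" "expo M \<tau>" "\<not> passed M \<rho>"
      unfolding rot_lt_iff using r(1) \<tau>r \<open>\<tau> \<noteq> \<rho>\<close> by auto
    \<comment> \<open>The join lacks \<open>\<rho>\<close> because of \<open>M\<close>, lies above
      \<open>T\<close> because of the other argument, and still exposes \<open>\<tau>\<close>.
      Eliminating \<open>\<tau>\<close> there stays within \<open>P\<close>, so \<open>S\<close>
      must have passed \<open>\<tau>\<close>, although \<open>\<tau>\<close> is still exposed after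
      \<open>S\<close>.\<close>
    let ?J = "join M (eliminate S \<rho>)"
    have J: "stab ?J" "expo ?J \<tau>" "dom ?J M" "dom ?J (eliminate S \<rho>)"
      using join_facts(1)[OF M(1) E(1)] expo_join[OF M(1) E(1) M(2) \<tau>(1)] dom_join[OF M(1) E(1)] by auto
    have JT: "dom ?J T" using dom_trans[OF J(4) E(2)] .
    have "\<not> passed ?J \<rho>" using passed_mono[OF r(1) J(3)] M(3) by blast
    then have "\<not> passed (eliminate ?J \<tau>) \<rho>"
      using eliminate_newly_passed[OF J(1,2) r(1)] \<open>\<tau> \<noteq> \<rho>\<close> by blast
    then have "P (eliminate ?J \<tau>)"
      using eliminate_facts(1)[OF J(1,2)] eliminate_dom[OF J(1) T(1) J(2) JT \<tau>(2)] unfolding P_def by blast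
    then have "passed S \<tau>" using passed_mono[OF \<tau>r S_max passed_eliminate[OF J(1,2)]] by blast
    then show False using passed_mono[OF \<tau>r dom_eliminate[OF S(1) \<sigma>(1)]] np by blast
  qed
  then show ?thesis using S \<sigma> T(2) p by blast
qed

text \<open>If no woman is shared, a triple of \<open>\<pi>\<close> that fails in \<open>S\<close>
  belongs to a man whom \<open>\<rho>\<close> does not move. He is held up in \<open>S\<close> by an
  earlier woman \<open>v\<close> who would accept him there but not after the elimination; so her
  husband changes and \<open>v\<close> belongs to \<open>\<rho>\<close>.\<close>

lemma adjacent_local:
  assumes S: "stab S" "expo S \<rho>" and \<pi>: "expo (eliminate S \<rho>) \<pi>" "\<not> expo S \<pi>"
  shows "(\<exists>w a b c d. (a, w, b) \<in> \<rho> \<and> (c, w, d) \<in> \<pi>) \<or>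
    (\<exists>m w w' a v b. (m, w, w') \<in> \<pi> \<and> (a, v, b) \<in> \<rho> \<and> pm m w < pm m v \<and> pm m v < pm m w')"
  unfolding disj_imp
proof (rule impI)
  assume disj: "\<not> (\<exists>w a b c d. (a, w, b) \<in> \<rho> \<and> (c, w, d) \<in> \<pi>)"
  let ?S = "eliminate S \<rho>"
  note el = eliminate_facts[OF S]
  obtain m w w' where t: "(m, w, w') \<in> \<pi>" "\<not> ((m, w) \<in> S \<and> next_woman n pm pw S m w')"
    using expo_transfer[OF \<pi>(1), of S] \<pi>(2) by blast
  note e = expoE[OF \<pi>(1) el(1) t(1)]
  have "(m, x, y) \<notin> \<rho>" for x y
  proof
    assume mem: "(m, x, y) \<in> \<rho>"
    then have "y = w" using el(2) e(4) by simp
    then show False using expo_succ[OF S(2) mem] disj t(1) by blast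
  qed
  then have wS: "wife S m = w" using el(3)[OF e(1)] e(4) by simp
  then have "\<not> next_woman n pm pw S m w'" using t(2) pair_wife[OF S(1)] e(1) by simp
  moreover have "pw w' m < woman_rank S w'"
    using e(7) woman_dom[OF S(1) el(1) dom_eliminate[OF S] e(3)] by simp
  ultimately obtain v where v: "v < n" "pm m w < pm m v" "pm m v < pm m w'" "pw v m < woman_rank S v"
    unfolding next_woman_iff[OF S(1)] using e(1,3,6) wS by (auto simp: not_le)
  have h: "husb S v < n" "wife S (husb S v) = v" using S(1) v(1) by simp_all
  have "husb ?S v \<noteq> husb S v" using e(8)[OF v(1-3)] v(4) by auto
  then have "wife ?S (husb S v) \<noteq> v" using husb_wife[OF el(1) h(1)] by auto
  then obtain x y where "(husb S v, x, y) \<in> \<rho>" using el(3)[OF h(1)] h(2) by auto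
  moreover from this have "x = v" using expoE(4)[OF S(2,1)] h(2) by simp
  ultimately show "\<exists>m w w' a v b. (m, w, w') \<in> \<pi> \<and> (a, v, b) \<in> \<rho> \<and> pm m w < pm m v \<and> pm m v < pm m w'"
    using t(1) v by blast
qed

end

subsection \<open>Positions under k-range preferences\<close>

text \<open>Pigeonhole: exactly \<open>p\<close> agents have \<open>f\<close>-rank below
  \<open>p\<close>, and \<open>q \<circ> h\<close> injects them into the numbers below
  \<open>c\<close>. It is applied with a partner function as \<open>h\<close>.\<close>

lemma rank_le_of_inj:
  fixes f q h :: "nat \<Rightarrow> nat"
  assumes f: "bij_betw f {..<n} {..<n}" "p < n"
    and h: "inj_on h {..<n}" "\<And>w. w < n \<Longrightarrow> h w < n" and q: "inj_on q {..<n}"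
    and less: "\<And>w. w < n \<Longrightarrow> f w < p \<Longrightarrow> q (h w) < c"
  shows "p \<le> c"
proof -
  define A where "A = {w. w < n \<and> f w < p}"
  have fin: "finite A" and sub: "A \<subseteq> {..<n}" unfolding A_def by auto
  have "{..<p} \<subseteq> f ` A"
  proof
    fix x assume "x \<in> {..<p}"
    moreover from this have "x \<in> f ` {..<n}" using f unfolding bij_betw_def by auto
    ultimately show "x \<in> f ` A" unfolding A_def by auto
  qed
  then have "p \<le> card A" using surj_card_le[OF fin] by fastforce
  moreover have "inj_on (q \<circ> h) A"
    using h q sub by (intro comp_inj_on inj_on_subset[OF h(1) sub] inj_on_subset[OF q]) auto
  moreover have "(q \<circ> h) ` A \<subseteq> {..<c}" using less unfolding A_def by auto
  ultimately show ?thesis using card_inj_on_le[of "q \<circ> h" A "{..<c}"] by simp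
qed

locale sm_range = sm +
  fixes k :: nat
  assumes range: "k_range n pm pw k"
begin

lemma pm_range: "m < n \<Longrightarrow> m' < n \<Longrightarrow> w < n \<Longrightarrow> int (pm m w) \<le> int (pm m' w) + int k - 1"
  using range unfolding k_range_def by (smt (verit))

lemma pw_range: "w < n \<Longrightarrow> w' < n \<Longrightarrow> m < n \<Longrightarrow> int (pw w m) \<le> int (pw w' m) + int k - 1"
  using range unfolding k_range_def by (smt (verit))

lemma pm_bij: "m < n \<Longrightarrow> bij_betw (pm m) {..<n} {..<n}"
  using inst unfolding sm_instance_def by blast

lemma pw_bij: "w < n \<Longrightarrow> bij_betw (pw w) {..<n} {..<n}"
  using inst unfolding sm_instance_def by blast

lemma pm_lt: "m < n \<Longrightarrow> w < n \<Longrightarrow> pm m w < n"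
  using pm_bij bij_betwE by blast

lemma pw_lt: "m < n \<Longrightarrow> w < n \<Longrightarrow> pw w m < n"
  using pw_bij bij_betwE by blast

text \<open>Comparing an agent's rank with itself suffices. This keeps the natural number
  \<open>k - 1\<close> in the next bounds from being truncated.\<close>

lemma k_pos: "m < n \<Longrightarrow> 1 \<le> k"
  using pm_range[of m m m] by simp

text \<open>The women whom \<open>m\<close> prefers to his partner are all married to men that they rank above \<open>m\<close>,
  and the ranks of men hardly depend on the woman, so there are few such men.\<close>

lemma man_rank_bound:
  assumes M: "stab M" and m: "m < n" "w\<^sub>0 < n"
  shows "int (man_rank M m) \<le> int (pw w\<^sub>0 m) + 2 * int k - 2"
proof -
  \<comment> \<open>One \<open>k - 1\<close> pays for judging the husband by
    \<open>w\<^sub>0\<close> instead of \<open>w\<close>, the other for judging \<open>m\<close> by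
    \<open>w\<^sub>0\<close>.\<close>
  have "man_rank M m \<le> pw w\<^sub>0 m + 2 * (k - 1)"
  proof (rule rank_le_of_inj[where h = "husb M" and q = "pw w\<^sub>0"])
    show "bij_betw (pm m) {..<n} {..<n}" using pm_bij[OF m(1)] .
    show "man_rank M m < n" using pm_lt[OF m(1) wife_lt[OF M m(1)]] .
    show "inj_on (husb M) {..<n}"
      by (rule inj_on_inverseI[where g = "wife M"]) (simp add: M)
    show "inj_on (pw w\<^sub>0) {..<n}" using pw_bij[OF m(2)] bij_betw_imp_inj_on by blast
    show "husb M w < n" if "w < n" for w using husb_lt[OF M that] .
    fix w assume w: "w < n" "pm m w < man_rank M m"
    have "woman_rank M w < pw w m" using no_block[OF M m(1) w] .
    moreover have "int (pw w\<^sub>0 (husb M w)) \<le> int (woman_rank M w) + int k - 1"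
      using pw_range[OF m(2) w(1) husb_lt[OF M w(1)]] .
    moreover have "int (pw w m) \<le> int (pw w\<^sub>0 m) + int k - 1" using pw_range[OF w(1) m(2,1)] .
    ultimately show "pw w\<^sub>0 (husb M w) < pw w\<^sub>0 m + 2 * (k - 1)" using k_pos[OF m(1)] by linarith
  qed
  then show ?thesis using k_pos[OF m(1)] by linarith
qed

lemma woman_rank_bound:
  assumes M: "stab M" and w: "w < n" "m\<^sub>0 < n"
  shows "int (woman_rank M w) \<le> int (pm m\<^sub>0 w) + 2 * int k - 2"
proof -
  have "woman_rank M w \<le> pm m\<^sub>0 w + 2 * (k - 1)"
  proof (rule rank_le_of_inj[where h = "wife M" and q = "pm m\<^sub>0"])
    show "bij_betw (pw w) {..<n} {..<n}" using pw_bij[OF w(1)] .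
    show "woman_rank M w < n" using pw_lt[OF husb_lt[OF M w(1)] w(1)] .
    show "inj_on (wife M) {..<n}"
      by (rule inj_on_inverseI[where g = "husb M"]) (simp add: M)
    show "inj_on (pm m\<^sub>0) {..<n}" using pm_bij[OF w(2)] bij_betw_imp_inj_on by blast
    show "wife M m < n" if "m < n" for m using wife_lt[OF M that] .
    fix m assume m: "m < n" "pw w m < woman_rank M w"
    have "man_rank M m < pm m w" using no_block_woman[OF M m(1) w(1) m(2)] .
    moreover have "int (pm m\<^sub>0 (wife M m)) \<le> int (man_rank M m) + int k - 1"
      using pm_range[OF w(2) m(1) wife_lt[OF M m(1)]] .
    moreover have "int (pm m w) \<le> int (pm m\<^sub>0 w) + int k - 1" using pm_range[OF m(1) w(2,1)] .
    ultimately show "pm m\<^sub>0 (wife M m) < pm m\<^sub>0 w + 2 * (k - 1)" using k_pos[OF w(2)] by linarith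
  qed
  then show ?thesis using k_pos[OF w(2)] by linarith
qed

text \<open>The partner bounds contribute \<open>2 * k - 2\<close>, and moving the remaining rank to
  agent \<open>0\<close> costs another \<open>k - 1\<close>.\<close>

lemma stable_partners_close:
  assumes M: "stab M" and m: "m < n"
  shows "\<bar>int (pm 0 (wife M m)) - int (pw 0 m)\<bar> \<le> 3 * int k - 3"
proof -
  have w: "wife M m < n" and 0: "0 < n" using wife_lt[OF M m] m by auto
  have "int (pm 0 (wife M m)) \<le> int (man_rank M m) + int k - 1" using pm_range[OF 0 m w] .
  moreover have "int (pw 0 m) \<le> int (pw (wife M m) m) + int k - 1" using pw_range[OF 0 w m] .
  moreover have "int (pw (wife M m) m) \<le> int (pm 0 (wife M m)) + 2 * int k - 2"
    using woman_rank_bound[OF M w 0] M m by simp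
  ultimately show ?thesis using man_rank_bound[OF M m 0] by linarith
qed

text \<open>The rank given by agent \<open>0\<close> of the other side serves as position of an agent. A rotation
  occupies the positions between its women, extended by \<open>2k\<close> so that Hasse neighbours overlap.\<close>

definition bag :: "nat \<Rightarrow> rotation set" where
  "bag t = {\<rho> \<in> rots. (\<exists>a u b. (a, u, b) \<in> \<rho> \<and> pm 0 u \<le> t) \<and>
     (\<exists>c v d. (c, v, d) \<in> \<rho> \<and> t \<le> pm 0 v + 2 * k)}"

lemma bagI:
  "\<rho> \<in> rots \<Longrightarrow> (a, u, b) \<in> \<rho> \<Longrightarrow> pm 0 u \<le> t \<Longrightarrow> (c, v, d) \<in> \<rho> \<Longrightarrow> t \<le> pm 0 v + 2 * k \<Longrightarrow> \<rho> \<in> bag t"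
  unfolding bag_def by blast

text \<open>Going around the cycle, some step of the rotation must jump over the position \<open>t\<close>.\<close>

lemma bag_crossing:
  assumes "\<rho> \<in> bag t"
  shows "\<exists>m w w'. (m, w, w') \<in> \<rho> \<and> pm 0 w \<le> t \<and> t \<le> pm 0 w' + 2 * k"
proof (rule ccontr)
  assume no: "\<not> ?thesis"
  obtain a u b c v d where \<rho>: "\<rho> \<in> rots" and u: "(a, u, b) \<in> \<rho>" "pm 0 u \<le> t"
    and v: "(c, v, d) \<in> \<rho>" "t \<le> pm 0 v + 2 * k"
    using assms unfolding bag_def by blast
  obtain M where M: "stab M" "expo M \<rho>" using rotsE[OF \<rho>] .
  obtain m v0 where v0: "(m, v0, v) \<in> \<rho>" using expo_pred[OF M(2) v(1)] by blast
  from M(2) u(1) v0 have "pm 0 v0 \<le> t"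
  proof (induction rule: expo_cyclic_induct)
    case start
    then show ?case using u(2) .
  next
    case (step a b c d e)
    then have "\<not> t \<le> pm 0 c + 2 * k" using no by blast
    then show ?case by simp
  qed
  then show False using no v0 v(2) by blast
qed

text \<open>By \<open>rots_eq\<close> the first man and woman of a crossing triple determine the
  rotation, so it suffices to count their possible positions.\<close>

lemma card_bag: "card (bag t) \<le> 50 * k ^ 2 + 1"
proof (cases "bag t = {}")
  case True
  then show ?thesis by simp
next
  case False
  have rots: "\<rho> \<in> rots" if "\<rho> \<in> bag t" for \<rho> using that unfolding bag_def by blast
  have "\<exists>m w w'. (m, w, w') \<in> \<rho> \<and> pm 0 w \<le> t \<and> t \<le> pm 0 w' + 2 * k" if "\<rho> \<in> bag t" for \<rho>
    using bag_crossing[OF that] .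
  then obtain fm fw fw' where f: "\<And>\<rho>. \<rho> \<in> bag t \<Longrightarrow>
      (fm \<rho>, fw \<rho>, fw' \<rho>) \<in> \<rho> \<and> pm 0 (fw \<rho>) \<le> t \<and> t \<le> pm 0 (fw' \<rho>) + 2 * k"
    by metis
  define K where "K = int k"
  define g where "g \<rho> = (int (pw 0 (fm \<rho>)), int (pm 0 (fw \<rho>)) - int (pw 0 (fm \<rho>)))" for \<rho>
  \<comment> \<open>Both \<open>fw \<rho>\<close> and \<open>fw' \<rho>\<close> are within
    \<open>3 * K - 3\<close> of the man. The first is at most \<open>t\<close>, which bounds him
    above; the second is at least \<open>t - 2 * K\<close>, which bounds him below. This leaves
    \<open>8 * K - 5\<close> positions for him and \<open>6 * K - 5\<close> offsets for his
    wife.\<close>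
  define R where "R = {int t - 5 * K + 3 .. int t + 3 * K - 3} \<times> {- (3 * K - 3) .. 3 * K - 3}"
  have tr: "fm \<rho> < n" "fw \<rho> < n" if "\<rho> \<in> bag t" for \<rho>
    using rots_triple[OF rots[OF that]] f[OF that] by blast+
  have img: "g ` bag t \<subseteq> R"
  proof (rule image_subsetI)
    fix \<rho> assume \<rho>: "\<rho> \<in> bag t"
    obtain M where M: "stab M" "expo M \<rho>" using rotsE[OF rots[OF \<rho>]] .
    have t: "(fm \<rho>, fw \<rho>, fw' \<rho>) \<in> \<rho>" using f[OF \<rho>] by blast
    note e = expoE[OF M(2,1) t] and el = eliminate_facts[OF M]
    have "\<bar>int (pm 0 (fw \<rho>)) - int (pw 0 (fm \<rho>))\<bar> \<le> 3 * K - 3"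
      using stable_partners_close[OF M(1) e(1)] e(4) K_def by simp
    \<comment> \<open>After the elimination \<open>fw' \<rho>\<close> is the man's wife in a stable
      matching, so the same bound applies.\<close>
    moreover have "\<bar>int (pm 0 (fw' \<rho>)) - int (pw 0 (fm \<rho>))\<bar> \<le> 3 * K - 3"
      using stable_partners_close[OF el(1) e(1)] el(2)[OF t] K_def by simp
    moreover have "int (pm 0 (fw \<rho>)) \<le> int t" "int t \<le> int (pm 0 (fw' \<rho>)) + 2 * K"
      using f[OF \<rho>] unfolding K_def by linarith+
    ultimately show "g \<rho> \<in> R" unfolding g_def R_def by auto
  qed
  have inj: "inj_on g (bag t)"
  proof (rule inj_onI)
    fix \<rho> \<pi> assume a: "\<rho> \<in> bag t" "\<pi> \<in> bag t" "g \<rho> = g \<pi>"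
    have 0: "0 < n" using tr(1)[OF a(1)] by simp
    have "pw 0 (fm \<rho>) = pw 0 (fm \<pi>)" "pm 0 (fw \<rho>) = pm 0 (fw \<pi>)" using a(3) unfolding g_def by auto
    then have "fm \<rho> = fm \<pi>" "fw \<rho> = fw \<pi>"
      using pw_inj[OF 0 tr(1)[OF a(1)] tr(1)[OF a(2)]] pm_inj[OF 0 tr(2)[OF a(1)] tr(2)[OF a(2)]] by auto
    then show "\<rho> = \<pi>" using rots_eq[OF rots[OF a(1)] rots[OF a(2)]] f[OF a(1)] f[OF a(2)] by metis
  qed
  have k1: "1 \<le> K" using False tr(1) k_pos K_def by fastforce
  have "card (bag t) \<le> card R"
    using card_inj_on_le[OF inj img] unfolding R_def by simp
  also have "card R = nat (8 * K - 5) * nat (6 * K - 5)"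
    unfolding R_def by (simp add: card_cartesian_product algebra_simps)
  also have "\<dots> = nat ((8 * K - 5) * (6 * K - 5))" using k1 by (simp add: nat_mult_distrib)
  also have "\<dots> \<le> nat (50 * K ^ 2 + 1)"
  proof (rule nat_mono)
    have "(8 * K - 5) * (6 * K - 5) \<le> (8 * K) * (6 * K)" using k1 by (intro mult_mono) auto
    also have "\<dots> = 48 * K ^ 2" by (simp add: power2_eq_square)
    also have "\<dots> \<le> 50 * K ^ 2 + 1" using zero_le_power2[of K] by linarith
    finally show "(8 * K - 5) * (6 * K - 5) \<le> 50 * K ^ 2 + 1" .
  qed
  also have "\<dots> = 50 * k ^ 2 + 1" unfolding K_def by (simp add: nat_add_distrib nat_mult_distrib nat_power_eq)
  finally show ?thesis .
qed

lemma cover_common_bag: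
  assumes lt: "rot_lt n pm pw \<rho> \<pi>"
    and cov: "\<not> (\<exists>c. rot_lt n pm pw \<rho> c \<and> rot_lt n pm pw c \<pi>)"
  shows "\<exists>t<n. \<rho> \<in> bag t \<and> \<pi> \<in> bag t"
proof -
  have r: "\<rho> \<in> rots" "\<pi> \<in> rots" using lt unfolding rot_lt_iff by auto
  obtain S where S: "stab S" "expo S \<rho>" "expo (eliminate S \<rho>) \<pi>" "\<not> expo S \<pi>"
    using cover_adjacent[OF assms] by blast
  from adjacent_local[OF this] show ?thesis
  proof (elim disjE exE conjE)
    fix w a b c d assume w: "(a, w, b) \<in> \<rho>" "(c, w, d) \<in> \<pi>"
    have "pm 0 w < n" using pm_lt[of 0 w] rots_triple(2)[OF r(1) w(1)] by simp
    moreover have "\<rho> \<in> bag (pm 0 w)" by (rule bagI[OF r(1) w(1) _ w(1)]) auto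
    moreover have "\<pi> \<in> bag (pm 0 w)" by (rule bagI[OF r(2) w(2) _ w(2)]) auto
    ultimately show ?thesis by blast
  next
    fix m w w' a v b
    assume p: "(m, w, w') \<in> \<pi>" "(a, v, b) \<in> \<rho>" "pm m w < pm m v" "pm m v < pm m w'"
    note tp = rots_triple[OF r(2) p(1)] and tr = rots_triple[OF r(1) p(2)]
    have 0: "0 < n" using tp(1) by simp
    obtain d e where d: "(d, w', e) \<in> \<pi>" using expo_succ[OF S(3) p(1)] by blast
    \<comment> \<open>The order of \<open>w\<close>, \<open>v\<close>, \<open>w'\<close> is known in
      the list of \<open>m\<close> only. Moving each comparison to man \<open>0\<close> costs
      \<open>k - 1\<close> twice, which the slack \<open>2 * k\<close> of the bags absorbs.\<close>
    have "int (pm 0 w) \<le> int (pm m w) + int k - 1" "int (pm m v) \<le> int (pm 0 v) + int k - 1"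
      "int (pm 0 v) \<le> int (pm m v) + int k - 1" "int (pm m w') \<le> int (pm 0 w') + int k - 1"
      using pm_range[OF 0 tp(1,2)] pm_range[OF tp(1) 0 tr(2)] pm_range[OF 0 tp(1) tr(2)]
        pm_range[OF tp(1) 0 tp(3)] by auto
    then have le: "pm 0 w \<le> pm 0 v + 2 * k" "pm 0 v \<le> pm 0 w' + 2 * k" using p(3,4) by linarith+
    show ?thesis
    \<comment> \<open>The common bag is at the larger of the positions of \<open>v\<close> and
      \<open>w\<close>. In the second case \<open>w'\<close>, also a woman of \<open>\<pi>\<close>,
      supplies the right end.\<close>
    proof (cases "pm 0 v \<le> pm 0 w")
      case True
      have "\<rho> \<in> bag (pm 0 w)" by (rule bagI[OF r(1) p(2) True p(2) le(1)])
      moreover have "\<pi> \<in> bag (pm 0 w)" by (rule bagI[OF r(2) p(1) _ p(1)]) auto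
      ultimately show ?thesis using pm_lt[OF 0 tp(2)] by blast
    next
      case False
      have "\<rho> \<in> bag (pm 0 v)" by (rule bagI[OF r(1) p(2) _ p(2)]) auto
      moreover have "\<pi> \<in> bag (pm 0 v)" by (rule bagI[OF r(2) p(1) _ d le(2)]) (use False in simp)
      ultimately show ?thesis using pm_lt[OF 0 tr(2)] by blast
    qed
  qed
qed

text \<open>Membership in \<open>bag t\<close> asks for a lower and an upper threshold on
  \<open>t\<close>, so each rotation occupies an interval of indices. All positions are below
  \<open>n\<close>, hence \<open>n\<close> bags suffice.\<close>

lemma path_decomposition_bags: "path_decomposition rots (hasse_edge n pm pw) (map bag [0..<n])"
  unfolding path_decomposition_def
proof (intro conjI ballI allI impI)
  show "X \<subseteq> rots" if "X \<in> set (map bag [0..<n])" for X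
    using that unfolding bag_def by auto
  show "rots \<subseteq> \<Union> (set (map bag [0..<n]))"
  proof
    fix \<rho> assume \<rho>: "\<rho> \<in> rots"
    then obtain m w w' where t: "(m, w, w') \<in> \<rho>" using rotsE[OF \<rho>] expo_nonempty by metis
    have "\<rho> \<in> bag (pm 0 w)" by (rule bagI[OF \<rho> t _ t]) auto
    moreover have "pm 0 w < n" using pm_lt[of 0 w] rots_triple(2)[OF \<rho> t] by simp
    ultimately show "\<rho> \<in> \<Union> (set (map bag [0..<n]))" by auto
  qed
  show "\<exists>X\<in>set (map bag [0..<n]). u \<in> X \<and> v \<in> X" if "hasse_edge n pm pw u v" for u v
  proof -
    have "\<exists>t<n. u \<in> bag t \<and> v \<in> bag t"
      using that cover_common_bag[of u v] cover_common_bag[of v u]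
      unfolding hasse_edge_def Let_def by blast
    then show ?thesis by auto
  qed
  fix i j l assume a: "i \<le> j \<and> j \<le> l \<and> l < length (map bag [0..<n])"
  have "bag i \<inter> bag l \<subseteq> bag j"
  proof
    fix \<rho> assume "\<rho> \<in> bag i \<inter> bag l"
    then obtain x u y c v d where "\<rho> \<in> rots" "(x, u, y) \<in> \<rho>" "pm 0 u \<le> i"
      "(c, v, d) \<in> \<rho>" "l \<le> pm 0 v + 2 * k" unfolding bag_def by blast
    then show "\<rho> \<in> bag j" using a bagI[of \<rho> x u y j c v d] by simp
  qed
  then show "map bag [0..<n] ! i \<inter> map bag [0..<n] ! l \<subseteq> map bag [0..<n] ! j"
    using a by simp
qed

lemma pathwidth_rotations: "pathwidth rots (hasse_edge n pm pw) \<le> 50 * k ^ 2"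
  unfolding pathwidth_def using path_decomposition_bags card_bag
  by (intro Least_le exI[of _ "map bag [0..<n]"]) auto

end

theorem theorem7p9:
  fixes n k :: nat and pm pw :: "nat \<Rightarrow> nat \<Rightarrow> nat"
  assumes "sm_instance n pm pw"
    and "k_range n pm pw k"
  shows "pathwidth (rotations n pm pw) (hasse_edge n pm pw) \<le> 50 * k ^ 2"
proof -
  interpret sm_range n pm pw k by unfold_locales (fact assms)+
  show ?thesis by (rule pathwidth_rotations)
qed

end
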